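(* Let $\varphi$ be the Thue--Morse morphism and $\mathbf{s}$ a Sturmian word. For each $k\ge0$, the word $\mathbf{s}_k:=\varphi^k(\mathbf{s})$ satisfies $b^{(1)}_{\mathbf{s}_k}\prec b^{(2)}_{\mathbf{s}_k}\prec\cdots\prec b^{(k+1)}_{\mathbf{s}_k}\prec b^{(k+2)}_{\mathbf{s}_k}=p_{\mathbf{s}_k}$. In particular, taking for $\mathbf{s}$ the Fibonacci word (the fixed point of $0\mapsto01$, $1\mapsto0$) yields a morphic word with this property.
   Context: $\varphi\colon 0\mapsto01$, $1\mapsto10$. A Sturmian word is an infinite word with exactly $n+1$ factors of length $n$ for all $n$. For words $u,w$, $\binom{u}{w}$ is the number of occurrences of $w$ as a scattered subword of $u$; $u\sim_j v$ if $\binom{u}{x}=\binom{v}{x}$ for all words $x$ of length at most $j$. $b^{(j)}_{\mathbf{x}}(n)$ is the number of $\sim_j$-classes among the length-$n$ factors of $\mathbf{x}$, and $p_{\mathbf{x}}(n)$ is the number of length-$n$ factors of $\mathbf{x}$ (factor complexity). For $f,g\colon\mathbb{N}\to\mathbb{N}$, $f\prec g$ means $f(n)<g(n)$ for infinitely many $n$. A word is morphic if it is the image under a letter-to-letter map (coding) of a fixed point of a morphism. *)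

theory Defs
  imports Main "HOL-Library.Z2"
begin

text \<open>Finite words are lists, infinite words are functions on \<^typ>\<open>nat\<close>, and the binary
  alphabet is the two-element type \<^typ>\<open>bit\<close>.\<close>

definition factors :: "(nat \<Rightarrow> 'a) \<Rightarrow> nat \<Rightarrow> 'a list set" where
  "factors x n = {map x [i..<i + n] | i. True}"

definition factor_complexity :: "(nat \<Rightarrow> 'a) \<Rightarrow> nat \<Rightarrow> nat" where
  "factor_complexity x n = card (factors x n)"

definition sturmian :: "(nat \<Rightarrow> 'a) \<Rightarrow> bool" where
  "sturmian x \<longleftrightarrow> (\<forall>n. card (factors x n) = n + 1)"

text \<open>An occurrence of \<open>w\<close> as a scattered subword of \<open>u\<close> is a set of positions of \<open>u\<close>
  that spells \<open>w\<close> when read in increasing order.\<close>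

definition word_binomial :: "'a list \<Rightarrow> 'a list \<Rightarrow> nat" where
  "word_binomial u w = card {I. I \<subseteq> {..<length u} \<and> nths u I = w}"

definition binomial_equiv :: "nat \<Rightarrow> ('a list \<times> 'a list) set" where
  "binomial_equiv j =
    {(u, v). \<forall>x. length x \<le> j \<longrightarrow> word_binomial u x = word_binomial v x}"

definition binomial_complexity :: "nat \<Rightarrow> (nat \<Rightarrow> 'a) \<Rightarrow> nat \<Rightarrow> nat" where
  "binomial_complexity j x n = card (factors x n // binomial_equiv j)"

definition inf_often_less :: "(nat \<Rightarrow> nat) \<Rightarrow> (nat \<Rightarrow> nat) \<Rightarrow> bool" where
  "inf_often_less f g \<longleftrightarrow> infinite {n. f n < g n}"

text \<open>A morphism is given by its images of letters.\<close>

definition morph_word :: "('a \<Rightarrow> 'b list) \<Rightarrow> 'a list \<Rightarrow> 'b list" where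
  "morph_word h u = concat (map h u)"

text \<open>The \<open>n\<close>-th letter of the image of an infinite word is read off the image of any prefix
  whose image has more than \<open>n\<close> letters. The value is meaningful only if the image is infinite,
  which is the case for every non-erasing \<open>h\<close>, and also for \<open>h\<close> prolongable on the first letter
  of a word it fixes.\<close>

definition morph_image :: "('a \<Rightarrow> 'b list) \<Rightarrow> (nat \<Rightarrow> 'a) \<Rightarrow> nat \<Rightarrow> 'b" where
  "morph_image h x n =
    morph_word h (map x [0..<(LEAST m. n < length (morph_word h (map x [0..<m])))]) ! n"

definition prolongable :: "('a \<Rightarrow> 'a list) \<Rightarrow> 'a \<Rightarrow> bool" where
  "prolongable h a \<longleftrightarrow> (\<exists>u. h a = a # u \<and> (\<forall>n. (morph_word h ^^ n) u \<noteq> []))"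

text \<open>The fixed point must start with a letter on which the morphism is prolongable; otherwise
  the identity morphism would make every word over a finite alphabet morphic. The finite alphabet
  \<open>A\<close> of the fixed point is, without loss of generality, a set of natural numbers.\<close>

definition morphic :: "(nat \<Rightarrow> 'a) \<Rightarrow> bool" where
  "morphic w \<longleftrightarrow>
    (\<exists>(A :: nat set) (h :: nat \<Rightarrow> nat list) (x :: nat \<Rightarrow> nat) (c :: nat \<Rightarrow> 'a).
      finite A \<and> range x \<subseteq> A \<and> (\<forall>a\<in>A. set (h a) \<subseteq> A) \<and>
      prolongable h (x 0) \<and> morph_image h x = x \<and> w = c \<circ> x)"

definition thue_morse :: "bit \<Rightarrow> bit list" where
  "thue_morse a = (if a = 0 then [0, 1] else [1, 0])"

definition fibonacci_morphism :: "bit \<Rightarrow> bit list" where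
  "fibonacci_morphism a = (if a = 0 then [0, 1] else [0])"

definition fibonacci_word :: "nat \<Rightarrow> bit" where
  "fibonacci_word = (THE x. morph_image fibonacci_morphism x = x)"

definition thue_morse_iterate :: "nat \<Rightarrow> (nat \<Rightarrow> bit) \<Rightarrow> nat \<Rightarrow> bit" where
  "thue_morse_iterate k = morph_image thue_morse ^^ k"

definition strict_binomial_chain :: "nat \<Rightarrow> (nat \<Rightarrow> 'a) \<Rightarrow> bool" where
  "strict_binomial_chain k x \<longleftrightarrow>
    (\<forall>j\<in>{1..k + 1}. inf_often_less (binomial_complexity j x) (binomial_complexity (j + 1) x)) \<and>
    binomial_complexity (k + 2) x = factor_complexity x"

end

theory Submission imports Defs "HOL-Computational_Algebra.Polynomial" begin

text \<open>To a binary word \<open>u\<close> of length \<open>n\<close> attach the polynomial \<open>Q(u) = \<Sum> \<epsilon>(u\<^sub>i) (1 + Y)\<^bsup>n-1-i\<^esup>\<close>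
  with \<open>\<epsilon>(0) = 1\<close>, \<open>\<epsilon>(1) = -1\<close>. Its coefficients of degree less than \<open>m\<close> are combinations of the
  binomials of \<open>u\<close> with words of length at most \<open>m\<close>, so \<open>u \<sim>\<^sub>m v\<close> implies \<open>Y\<^bsup>m\<^esup> | Q(u) - Q(v)\<close>. Moreover
  \<open>Q(\<phi>(u)) = Y Q(u)(2Y + Y\<^sup>2)\<close>, so \<open>\<phi>\<close> raises the order of vanishing of a difference by exactly
  one. Conversely, \<open>u \<sim>\<^sub>j v\<close> and \<open>|u| = |v|\<close> imply \<open>\<phi>(u) \<sim>\<^sub>j\<^sub>+\<^sub>1 \<phi>(v)\<close>. Together these give the strict
  inequalities: start from two factors of equal length of \<open>\<phi>\<^bsup>k-j\<^esup>(s)\<close> with different numbers of ones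
  and apply \<open>\<phi>\<^bsup>j\<^esup>\<close>, or, for \<open>j = k + 1\<close>, from two distinct abelian equivalent factors of \<open>s\<close>.

  For the final equality, two factors of \<open>\<phi>(y)\<close> with \<open>Y\<^sup>2 | Q(U) - Q(V)\<close> are either equal or of
  the form \<open>p \<phi>(u) q\<close> and \<open>p \<phi>(v) q\<close> with \<open>|u| = |v|\<close>. This reduces \<open>\<phi>\<^bsup>k\<^esup>(s)\<close> and order \<open>k + 2\<close> to \<open>s\<close>
  and order \<open>2\<close>, where balance of Sturmian words applies.\<close>

section \<open>Binomial equivalence and the Thue--Morse morphism\<close>

lemma word_binomial_Nil_left: "word_binomial [] w = (if w = [] then 1 else 0)"
proof -
  have "{I. I \<subseteq> {..<length []} \<and> nths [] I = w} = (if w = [] then {{}} else {})"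
    by auto
  then show ?thesis by (simp add: word_binomial_def)
qed

lemma word_binomial_Nil_right [simp]: "word_binomial u [] = 1"
proof -
  have "I = {}" if "I \<subseteq> {..<length u}" "nths u I = []" for I
  proof -
    have "length (nths u I) = card {i. i < length u \<and> i \<in> I}"
      by (simp add: length_nths)
    moreover have "{i. i < length u \<and> i \<in> I} = I" using that(1) by auto
    ultimately show ?thesis
      using that finite_subset[OF that(1)] by simp
  qed
  then have "{I. I \<subseteq> {..<length u} \<and> nths u I = []} = {{}}" by auto
  then show ?thesis by (simp add: word_binomial_def)
qed

lemma word_binomial_Cons_Cons:
  "word_binomial (c # u) (d # w) =
    word_binomial u (d # w) + (if c = d then word_binomial u w else 0)"
proof -
  let ?S = "\<lambda>u w. {I. I \<subseteq> {..<length u} \<and> nths u I = w}"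
  let ?f = "\<lambda>I. Suc ` I" and ?g = "\<lambda>I. insert 0 (Suc ` I)"
  have fin: "finite (?S u w)" for u :: "'a list" and w by simp
  have split: "?S (c # u) (d # w) =
      ?f ` ?S u (d # w) \<union> (if c = d then ?g ` ?S u w else {})" (is "?L = ?R")
  proof (intro equalityI subsetI)
    fix I assume I: "I \<in> ?L"
    let ?J = "{j. Suc j \<in> I}"
    have J: "?J \<subseteq> {..<length u}" using I by auto
    have IJ: "I = (if 0 \<in> I then ?g ?J else ?f ?J)"
      by (auto simp: image_iff) (metis not0_implies_Suc)+
    show "I \<in> ?R"
    proof (cases "0 \<in> I")
      case True
      then have "c = d" "nths u ?J = w" using I by (auto simp: nths_Cons)
      then have "?J \<in> ?S u w" using J by simp
      moreover have "I = ?g ?J" using IJ True by simp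
      ultimately have "I \<in> ?g ` ?S u w" by (rule image_eqI[rotated])
      then show ?thesis using \<open>c = d\<close> by simp
    next
      case False
      then have "?J \<in> ?S u (d # w)" using I J by (auto simp: nths_Cons)
      moreover have "I = ?f ?J" using IJ False by simp
      ultimately show ?thesis by blast
    qed
  next
    fix I assume "I \<in> ?R"
    then show "I \<in> ?L"
      by (auto simp: nths_Cons image_iff split: if_splits)
  qed
  have disj: "?f ` ?S u (d # w) \<inter> ?g ` ?S u w = {}" by auto
  have "inj_on ?f (?S u (d # w))"
    by (rule inj_onI) (simp add: inj_image_eq_iff)
  moreover have "inj_on ?g (?S u w)"
  proof (rule inj_onI)
    fix I J :: "nat set" assume "?g I = ?g J"
    then have "Suc ` I = Suc ` J" by (metis Diff_insert_absorb image_iff nat.distinct(1))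
    then show "I = J" by (simp add: inj_image_eq_iff)
  qed
  ultimately show ?thesis unfolding word_binomial_def split
    using disj by (simp add: card_Un_disjoint card_image)
qed

lemma binomial_equivD:
  "(u, v) \<in> binomial_equiv j \<Longrightarrow> length x \<le> j \<Longrightarrow> word_binomial u x = word_binomial v x"
  by (simp add: binomial_equiv_def)

lemma binomial_equiv_mono: "i \<le> j \<Longrightarrow> binomial_equiv j \<subseteq> binomial_equiv i"
  by (auto simp: binomial_equiv_def)

lemma equiv_binomial_equiv: "equiv UNIV (binomial_equiv j)"
  by (auto simp: binomial_equiv_def intro!: equivI refl_onI symI transI)

text \<open>Statistics of degree at most \<open>j\<close>, constant on the classes of
  \<open>binomial_equiv j\<close>; degrees are tracked without computing coefficients.\<close>

inductive_set binomial_span :: "nat \<Rightarrow> ('a list \<Rightarrow> nat) set" for j where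
  zero: "(\<lambda>_. 0) \<in> binomial_span j"
| binomial: "length w \<le> j \<Longrightarrow> (\<lambda>u. word_binomial u w) \<in> binomial_span j"
| add: "f \<in> binomial_span j \<Longrightarrow> g \<in> binomial_span j \<Longrightarrow> (\<lambda>u. f u + g u) \<in> binomial_span j"

lemma binomial_span_mono: "i \<le> j \<Longrightarrow> f \<in> binomial_span i \<Longrightarrow> f \<in> binomial_span j"
proof (rotate_tac, induction rule: binomial_span.induct)
qed (auto intro: binomial_span.intros)

lemma binomial_span_equiv:
  assumes "f \<in> binomial_span j" and "(u, v) \<in> binomial_equiv j"
  shows "f u = f v"
  using assms by (induction rule: binomial_span.induct) (auto dest: binomial_equivD)

text \<open>On binomials this operator prepends \<open>d\<close> to the pattern, so it raises the
  degree by one.\<close>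

fun suffix_sum :: "'a \<Rightarrow> ('a list \<Rightarrow> nat) \<Rightarrow> 'a list \<Rightarrow> nat" where
  "suffix_sum d f [] = 0"
| "suffix_sum d f (c # u) = suffix_sum d f u + (if c = d then f u else 0)"

lemma suffix_sum_binomial:
  "suffix_sum d (\<lambda>u. word_binomial u w) u = word_binomial u (d # w)"
  by (induction u) (simp_all add: word_binomial_Nil_left word_binomial_Cons_Cons)

lemma suffix_sum_in_span:
  assumes "f \<in> binomial_span j"
  shows "suffix_sum d f \<in> binomial_span (Suc j)"
  using assms
proof (induction rule: binomial_span.induct)
  case zero
  have "suffix_sum d (\<lambda>_. 0) = (\<lambda>_. 0)"
  proof
    show "suffix_sum d (\<lambda>_. 0) u = 0" for u by (induction u) auto
  qed
  then show ?case by (simp add: binomial_span.zero)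
next
  case (binomial w)
  have "suffix_sum d (\<lambda>u. word_binomial u w) = (\<lambda>u. word_binomial u (d # w))"
    by (rule ext) (rule suffix_sum_binomial)
  then show ?case using binomial by (simp add: binomial_span.binomial)
next
  case (add f g)
  have "suffix_sum d (\<lambda>u. f u + g u) = (\<lambda>u. suffix_sum d f u + suffix_sum d g u)"
  proof
    show "suffix_sum d (\<lambda>u. f u + g u) u = suffix_sum d f u + suffix_sum d g u" for u
      by (induction u) auto
  qed
  then show ?case using add by (simp add: binomial_span.add)
qed

text \<open>The two suffix sums together run over all proper suffixes, which gives the hockey-stick
  sum of \<open>i choose r\<close> over \<open>i < length u\<close>.\<close>

lemma length_choose_in_span: "(\<lambda>u :: bit list. length u choose r) \<in> binomial_span r"
proof (induction r)
  case 0
  show ?case using binomial_span.binomial[of "[]" 0] by simp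
next
  case (Suc r)
  have "(length u choose Suc r) =
      suffix_sum 0 (\<lambda>u. length u choose r) u + suffix_sum 1 (\<lambda>u. length u choose r) u"
    for u :: "bit list"
  proof (induction u)
    case (Cons c u)
    then show ?case by (cases c) auto
  qed simp
  then have "(\<lambda>u :: bit list. length u choose Suc r) = (\<lambda>u. suffix_sum 0 (\<lambda>u. length u choose r) u
      + suffix_sum 1 (\<lambda>u. length u choose r) u)" by blast
  then show ?case using Suc by (simp add: binomial_span.add suffix_sum_in_span)
qed

section \<open>Binomials of Thue--Morse images\<close>

lemma morph_word_simps [simp]:
  "morph_word h [] = []"
  "morph_word h (a # u) = h a @ morph_word h u"
  "morph_word h (u @ v) = morph_word h u @ morph_word h v"
  by (simp_all add: morph_word_def)

lemma thue_morse_eq: "thue_morse a = [a, a + 1]"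
  by (cases a) (simp_all add: thue_morse_def)

abbreviation tm_word :: "bit list \<Rightarrow> bit list" where
  "tm_word \<equiv> morph_word thue_morse"

lemma length_tm_word [simp]: "length (tm_word u) = 2 * length u"
  by (induction u) (simp_all add: thue_morse_eq)

lemma length_tm_word_iter [simp]: "length ((tm_word ^^ t) u) = 2 ^ t * length u"
  by (induction t) simp_all

lemma bit_eq_add_one_iff: "(c :: bit) + 1 = d \<longleftrightarrow> c \<noteq> d"
  by (cases c; cases d) simp_all

text \<open>The block of \<open>c\<close> contains each letter once. So one letter taken from it
  matches \<open>d\<close> in exactly one way, whatever \<open>c\<close> is; two letters match only
  if the block is \<open>[d, e]\<close>.\<close>

lemma tm_binomial_Cons:
  "word_binomial (tm_word (c # u)) (d # e # x) = word_binomial (tm_word u) (d # e # x)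
    + word_binomial (tm_word u) (e # x)
    + (if c = d \<and> d \<noteq> e then word_binomial (tm_word u) x else 0)"
  by (cases c; cases d; cases e) (simp_all add: thue_morse_eq word_binomial_Cons_Cons)

lemma tm_binomial_singleton: "word_binomial (tm_word u) [d] = length u"
  by (induction u)
    (auto simp: thue_morse_eq word_binomial_Nil_left word_binomial_Cons_Cons bit_eq_add_one_iff)

text \<open>The term with one letter from the block does not depend on \<open>c\<close>, hence the
  sum over both letters; the term with two letters occurs only at letters \<open>d\<close>.\<close>

lemma tm_binomial_suffix_sum:
  "word_binomial (tm_word u) (d # e # x) =
    suffix_sum 0 (\<lambda>u. word_binomial (tm_word u) (e # x)) u
    + suffix_sum 1 (\<lambda>u. word_binomial (tm_word u) (e # x)) u
    + (if d \<noteq> e then suffix_sum d (\<lambda>u. word_binomial (tm_word u) x) u else 0)"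
proof (induction u)
  case (Cons c u)
  show ?case
    unfolding tm_binomial_Cons Cons
    by (cases c; cases d; cases e) simp_all
qed (simp add: word_binomial_Nil_left)

text \<open>A bound without gain in degree. It serves for the term with two letters, whose pattern
  is already shorter by two.\<close>

lemma tm_binomial_in_span: "(\<lambda>u. word_binomial (tm_word u) x) \<in> binomial_span (length x)"
proof (induction x rule: induct_list012)
  case 1
  then show ?case using binomial_span.binomial[of "[]" 0] by simp
next
  case (2 d)
  then show ?case using length_choose_in_span[of 1] by (simp add: tm_binomial_singleton)
next
  case (3 d e x)
  have "suffix_sum d (\<lambda>u. word_binomial (tm_word u) x) \<in> binomial_span (length (d # e # x))"
    using suffix_sum_in_span[OF 3(1), of d] by (rule binomial_span_mono[rotated]) simp
  moreover have "suffix_sum c (\<lambda>u. word_binomial (tm_word u) (e # x))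
      \<in> binomial_span (length (d # e # x))" for c
    using suffix_sum_in_span[OF 3(2)] by simp
  ultimately show ?case
    unfolding tm_binomial_suffix_sum
    by (cases "d = e") (auto intro!: binomial_span.intros)
qed

text \<open>Summing over all suffixes, regardless of the preceding letter, sends a function of the length
  to a function of the length; this is why one degree is gained.\<close>

lemma tm_binomial_lower_degree:
  "length x \<le> Suc j \<Longrightarrow> \<exists>f \<in> binomial_span j. \<exists>g. \<forall>u. word_binomial (tm_word u) x = f u + g (length u)"
proof (induction j arbitrary: x)
  case 0
  then have "x = [] \<or> (\<exists>d. x = [d])" by (cases x) auto
  then show ?case
    by (intro bexI[OF _ binomial_span.zero] exI[of _ "if x = [] then (\<lambda>_. 1) else (\<lambda>n. n)"])
      (auto simp: tm_binomial_singleton)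
next
  case (Suc j)
  show ?case
  proof (cases "length x \<le> Suc j")
    case True
    then show ?thesis using Suc.IH binomial_span_mono[of j "Suc j"] by (meson le_SucI le_refl)
  next
    case False
    then obtain d e y where x: "x = d # e # y" "length y = j"
      using Suc.prems by (metis Suc_le_length_iff length_Cons linorder_not_less not_less_eq_eq
          old.nat.inject order_antisym_conv)
    obtain f g where f: "f \<in> binomial_span j"
      and fg: "\<And>u. word_binomial (tm_word u) (e # y) = f u + g (length u)"
      using Suc.IH[of "e # y"] x by auto
    \<comment> \<open>The part of the inner binomial that depends on the length only moves to the
      new \<open>g\<close>; the last summand has degree \<open>j + 1\<close> because
      \<open>y\<close> has length \<open>j\<close>.\<close>
    define f' where "f' = (\<lambda>u. suffix_sum 0 f u + suffix_sum 1 f u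
      + (if d \<noteq> e then suffix_sum d (\<lambda>u. word_binomial (tm_word u) y) u else 0))"
    have "f' \<in> binomial_span (Suc j)"
      unfolding f'_def using f tm_binomial_in_span[of y] x(2)
      by (cases "d = e") (auto intro!: binomial_span.add binomial_span.zero suffix_sum_in_span)
    moreover have "word_binomial (tm_word u) x = f' u + (\<Sum>i<length u. g i)" for u
    proof -
      have "suffix_sum 0 (\<lambda>u. f u + g (length u)) u + suffix_sum 1 (\<lambda>u. f u + g (length u)) u =
        suffix_sum 0 f u + suffix_sum 1 f u + (\<Sum>i<length u. g i)"
      proof (induction u)
        case (Cons c u)
        then show ?case by (cases c) simp_all
      qed simp
      then show ?thesis by (simp add: x tm_binomial_suffix_sum f'_def fg)
    qed
    ultimately show ?thesis by (intro bexI[of _ f'] exI[of _ "\<lambda>n. \<Sum>i<n. g i"]) auto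
  qed
qed

text \<open>The part \<open>g (length u)\<close> cancels only for equal lengths, which equivalence
  at \<open>j = 0\<close> does not provide.\<close>

lemma tm_word_binomial_equiv:
  assumes "(u, v) \<in> binomial_equiv j" and "length u = length v"
  shows "(tm_word u, tm_word v) \<in> binomial_equiv (Suc j)"
  unfolding binomial_equiv_def
proof (clarify)
  fix x :: "bit list" assume "length x \<le> Suc j"
  then obtain f g where "f \<in> binomial_span j"
    and "\<forall>u. word_binomial (tm_word u) x = f u + g (length u)"
    using tm_binomial_lower_degree by blast
  then show "word_binomial (tm_word u) x = word_binomial (tm_word v) x"
    using assms by (simp add: binomial_span_equiv)
qed

lemma tm_word_iter_binomial_equiv:
  assumes "(u, v) \<in> binomial_equiv j" and "length u = length v"
  shows "((tm_word ^^ t) u, (tm_word ^^ t) v) \<in> binomial_equiv (t + j)"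
  using assms by (induction t) (simp_all add: tm_word_binomial_equiv)

section \<open>Moments of binary words\<close>

definition letter_sign :: "bit \<Rightarrow> int" where
  "letter_sign a = (if a = 0 then 1 else -1)"

fun sign_poly :: "bit list \<Rightarrow> int poly" where
  "sign_poly [] = 0"
| "sign_poly (c # u) = sign_poly u + smult (letter_sign c) ([:1, 1:] ^ length u)"

lemma letter_sign_simps [simp]: "letter_sign 0 = 1" "letter_sign 1 = -1"
  "letter_sign (a + 1) = - letter_sign a" 
  by (cases a; simp add: letter_sign_def)+

lemma letter_sign_inject [simp]: "letter_sign a = letter_sign b \<longleftrightarrow> a = b"
  by (cases a; cases b) simp_all

lemma coeff_one_plus_X_power [simp]: "coeff ([:1, 1 :: int:] ^ n) r = int (n choose r)"
proof (cases "r \<le> n")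
  case False
  then show ?thesis
    by (simp add: coeff_eq_0 degree_linear_power binomial_eq_0)
qed (simp add: coeff_linear_poly_power)

lemma sign_poly_append:
  "sign_poly (u @ v) = sign_poly v + [:1, 1:] ^ length v * sign_poly u"
  by (induction u) (simp_all add: algebra_simps power_add)

text \<open>In terms of \<open>Z = 1 + Y\<close>, a block contributes a sign times
  \<open>(Z - 1) Z^(2m)\<close> if \<open>m\<close> letters of \<open>u\<close> follow, and
  \<open>Z^2 = 1 + (2Y + Y^2)\<close>.\<close>

lemma sign_poly_tm_word:
  "sign_poly (tm_word u) = [:0, 1:] * pcompose (sign_poly u) [:0, 2, 1:]"
proof (induction u)
  case (Cons c u)
  have sq: "[:1, 2, 1 :: int:] = [:1, 1:] ^ 2" by (simp add: power2_eq_square)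
  have "pcompose ([:1, 1 :: int:] ^ n) [:0, 2, 1:] = [:1, 1:] ^ (2 * n)" for n
    unfolding power_mult sq[symmetric]
    by (induction n) (simp_all add: pcompose_1 pcompose_add pcompose_pCons algebra_simps)
  then show ?case using Cons
    by (simp add: thue_morse_eq[of c] pcompose_add pcompose_smult algebra_simps)
qed simp

lemma coeff_sign_poly:
  "coeff (sign_poly u) r = int (suffix_sum 0 (\<lambda>u. length u choose r) u)
    - int (suffix_sum 1 (\<lambda>u. length u choose r) u)"
proof (induction u)
  case (Cons c u)
  then show ?case by (cases c) simp_all
qed simp

text \<open>The coefficient of degree \<open>r\<close> is a difference of two suffix sums of
  \<open>length u choose r\<close>, which have degree \<open>r + 1\<close>.\<close>

lemma binomial_equiv_imp_dvd_sign_poly: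
  assumes "(u, v) \<in> binomial_equiv m"
  shows "monom 1 m dvd sign_poly u - sign_poly v"
  unfolding monom_1_dvd_iff'
proof (intro allI impI)
  fix r assume "r < m"
  then have "suffix_sum d (\<lambda>u. length u choose r) \<in> binomial_span m" for d :: bit
    by (intro binomial_span_mono[OF _ suffix_sum_in_span[OF length_choose_in_span]]) simp
  then have "suffix_sum d (\<lambda>u. length u choose r) u = suffix_sum d (\<lambda>u. length u choose r) v"
    for d :: bit
    using assms by (rule binomial_span_equiv)
  then show "coeff (sign_poly u - sign_poly v) r = 0"
    by (simp add: coeff_sign_poly)
qed

text \<open>In degree \<open>k\<close> only \<open>coeff q 0 * coeff p k\<close> remains. A nonzero
  constant term is asked for instead of a unit because it is 2 in one application over
  \<open>int\<close>.\<close>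

lemma monom_dvd_mult_cancel_left:
  fixes p q :: "'a :: idom poly"
  assumes "monom 1 m dvd q * p" and "coeff q 0 \<noteq> 0"
  shows "monom 1 m dvd p"
proof -
  have "coeff p k = 0" if "k < m" for k
    using that
  proof (induction k rule: less_induct)
    case (less k)
    have "0 = coeff (q * p) k" using assms(1) less.prems unfolding monom_1_dvd_iff' by simp
    also have "\<dots> = (\<Sum>i\<in>{..k}. coeff q i * coeff p (k - i))" by (simp add: coeff_mult)
    also have "\<dots> = (\<Sum>i\<in>{0}. coeff q i * coeff p (k - i))"
      using less by (intro sum.mono_neutral_right) auto
    finally show ?case using assms(2) by simp
  qed
  then show ?thesis by (simp add: monom_1_dvd_iff')
qed

lemma monom_Suc_dvd_pCons_0_iff: "monom 1 (Suc m) dvd pCons 0 p \<longleftrightarrow> monom 1 m dvd p"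
  by (auto simp: monom_1_dvd_iff' coeff_pCons split: nat.splits)

text \<open>By Horner's scheme, \<open>p = a + Y p'\<close> is sent to \<open>a\<close> plus
  \<open>Y q\<close> times the image of \<open>p'\<close>; so \<open>a = 0\<close>, and one order
  less passes to \<open>p'\<close>.\<close>

lemma monom_dvd_pcompose_cancel:
  fixes p q :: "'a :: idom poly"
  assumes "monom 1 m dvd pcompose p ([:0, 1:] * q)" and q: "coeff q 0 \<noteq> 0"
  shows "monom 1 m dvd p"
  using assms(1)
proof (induction m arbitrary: p)
  case (Suc m)
  obtain a p' where p: "p = pCons a p'" by (rule pCons_cases)
  have "coeff (pcompose p ([:0, 1:] * q)) 0 = 0"
    using Suc.prems by (simp only: monom_1_dvd_iff')
  then have a: "a = 0" by (simp add: p)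
  have "monom 1 m dvd q * pcompose p' ([:0, 1:] * q)"
    using Suc.prems by (simp add: p a pcompose_pCons monom_Suc_dvd_pCons_0_iff)
  then have "monom 1 m dvd pcompose p' ([:0, 1:] * q)"
    using q by (rule monom_dvd_mult_cancel_left)
  then show ?case using Suc.IH[of p'] by (simp add: p a monom_Suc_dvd_pCons_0_iff)
qed simp

text \<open>The common prefix cancels since equally many letters follow it, the suffix contributes a
  power of \<open>1 + Y\<close>, and the factor \<open>Y\<close> accounts for the lost
  order.\<close>

lemma dvd_sign_poly_context_cancel:
  assumes "monom 1 (Suc m) dvd sign_poly (p @ tm_word u @ s) - sign_poly (p @ tm_word v @ s)"
    and "length u = length v"
  shows "monom 1 m dvd sign_poly u - sign_poly v"
proof -
  have "sign_poly (p @ tm_word u @ s) - sign_poly (p @ tm_word v @ s) =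
      [:1, 1:] ^ length s * ([:0, 1:] * pcompose (sign_poly u - sign_poly v) ([:0, 1:] * [:2, 1:]))"
    using assms(2) by (simp add: sign_poly_append sign_poly_tm_word pcompose_diff algebra_simps)
  then have "monom 1 (Suc m) dvd
      [:1, 1:] ^ length s * ([:0, 1:] * pcompose (sign_poly u - sign_poly v) ([:0, 1:] * [:2, 1:]))"
    using assms(1) by simp
  then have "monom 1 (Suc m) dvd [:0, 1:] * pcompose (sign_poly u - sign_poly v) ([:0, 1:] * [:2, 1:])"
    by (rule monom_dvd_mult_cancel_left) simp
  then have "monom 1 m dvd pcompose (sign_poly u - sign_poly v) ([:0, 1:] * [:2, 1:])"
    by (simp add: monom_Suc_dvd_pCons_0_iff)
  then show ?thesis by (rule monom_dvd_pcompose_cancel) simp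
qed

lemma dvd_sign_poly_tm_word_iter:
  assumes "monom 1 (t + i) dvd sign_poly ((tm_word ^^ t) u) - sign_poly ((tm_word ^^ t) v)"
    and "length u = length v"
  shows "monom 1 i dvd sign_poly u - sign_poly v"
  using assms
proof (induction t)
  case (Suc t)
  then show ?case
    using dvd_sign_poly_context_cancel[of "t + i" "[]" "(tm_word ^^ t) u" "[]" "(tm_word ^^ t) v"]
    by simp
qed simp

lemma coeff_sign_poly_0: "coeff (sign_poly u) 0 = (\<Sum>c\<leftarrow>u. letter_sign c)"
  by (induction u) simp_all

lemma coeff_0_append [simp]:
  "coeff (sign_poly (u @ v)) 0 = coeff (sign_poly u) 0 + coeff (sign_poly v) 0"
  by (simp add: coeff_sign_poly_0)

lemma coeff_1_append:
  "coeff (sign_poly (u @ v)) 1 = coeff (sign_poly u) 1 + coeff (sign_poly v) 1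
    + int (length v) * coeff (sign_poly u) 0"
  by (induction u) (simp_all add: algebra_simps)

section \<open>Desubstitution of factors of Thue--Morse images\<close>

lemma coeff_tm_word:
  "coeff (sign_poly (tm_word u)) 0 = 0"
  "coeff (sign_poly (tm_word u)) (Suc 0) = coeff (sign_poly u) 0"
  by (simp_all add: sign_poly_tm_word poly_0_coeff_0)

lemma abs_coeff_sign_poly_0_le: "\<bar>coeff (sign_poly u) 0\<bar> \<le> int (length u)"
proof (induction u)
  case (Cons c u)
  then show ?case by (cases c) simp_all
qed simp

lemma coeff_sign_poly_0_extremal:
  assumes "coeff (sign_poly u) 0 = int (length u) * letter_sign a"
  shows "u = replicate (length u) a"
  using assms
proof (induction u)
  case (Cons c u)
  have "\<bar>coeff (sign_poly u) 0\<bar> \<le> int (length u)" by (rule abs_coeff_sign_poly_0_le)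
  then show ?case using Cons by (cases c; cases a) simp_all
qed simp

text \<open>Both sides are the alternating word that starts with \<open>a\<close>, the only kind of
  word that can be cut into blocks in both ways.\<close>

lemma tm_word_replicate_shift: "tm_word (replicate n a) @ [a] = a # tm_word (replicate n (a + 1))"
  by (induction n) (cases a; simp add: thue_morse_eq)+

lemma sign_poly_singleton [simp]: "sign_poly [a] = [:letter_sign a:]"
  by simp

text \<open>If two factors of a Thue--Morse image are cut differently into blocks, the extreme letters
  contribute about twice the length to the first moment, which the blocks can match only if both
  words alternate.\<close>

lemma tm_misaligned_odd:
  assumes "length u = length v"
    and "coeff (sign_poly (tm_word u @ [b])) 0 = coeff (sign_poly (a # tm_word v)) 0"
    and "coeff (sign_poly (tm_word u @ [b])) 1 = coeff (sign_poly (a # tm_word v)) 1"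
  shows "tm_word u @ [b] = a # tm_word v"
proof -
  let ?n = "int (length v)"
  have ba: "b = a"
    using assms(2) coeff_0_append[of "[a]" "tm_word v"] coeff_0_append[of "tm_word u" "[b]"]
    by (simp add: coeff_tm_word)
  have "coeff (sign_poly u) 0 = coeff (sign_poly v) 0 + 2 * ?n * letter_sign a"
    using assms(3) coeff_1_append[of "[a]" "tm_word v"] coeff_1_append[of "tm_word u" "[b]"]
    by (simp add: coeff_tm_word mult.commute)
  moreover have "\<bar>coeff (sign_poly u) 0\<bar> \<le> ?n" "\<bar>coeff (sign_poly v) 0\<bar> \<le> ?n"
    using abs_coeff_sign_poly_0_le[of u] abs_coeff_sign_poly_0_le[of v] assms(1) by simp_all
  ultimately have "coeff (sign_poly u) 0 = int (length u) * letter_sign a"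
    and "coeff (sign_poly v) 0 = int (length v) * letter_sign (a + 1)"
    using assms(1) by (cases a; simp)+
  then have "u = replicate (length u) a" "v = replicate (length v) (a + 1)"
    using coeff_sign_poly_0_extremal by metis+
  then show ?thesis using tm_word_replicate_shift[of "length v" a] ba assms(1) by metis
qed

text \<open>Now both cut-off letters belong to one word. The zeroth moment makes them complementary,
  and the weight \<open>2 * length v + 1\<close> of \<open>a\<close> is the sum of the bounds for
  \<open>u\<close> and \<open>v\<close>, so both are extremal again.\<close>

lemma tm_misaligned_even:
  assumes "length u = Suc (length v)"
    and "coeff (sign_poly (tm_word u)) 0 = coeff (sign_poly (a # tm_word v @ [b])) 0"
    and "coeff (sign_poly (tm_word u)) 1 = coeff (sign_poly (a # tm_word v @ [b])) 1"
  shows "tm_word u = a # tm_word v @ [b]"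
proof -
  let ?n = "int (length v)"
  have "letter_sign b = - letter_sign a"
    using assms(2) coeff_0_append[of "[a]" "tm_word v @ [b]"] by (simp add: coeff_tm_word)
  then have ba: "b = a + 1" by (cases a; cases b) simp_all
  have "coeff (sign_poly u) 0 = coeff (sign_poly v) 0 + (2 * ?n + 1) * letter_sign a"
    using assms(3) coeff_1_append[of "[a]" "tm_word v @ [b]"] coeff_1_append[of "tm_word v" "[b]"]
    by (simp add: coeff_tm_word)
  moreover have "\<bar>coeff (sign_poly u) 0\<bar> \<le> ?n + 1" "\<bar>coeff (sign_poly v) 0\<bar> \<le> ?n"
    using abs_coeff_sign_poly_0_le[of u] abs_coeff_sign_poly_0_le[of v] assms(1) by simp_all
  ultimately have "coeff (sign_poly u) 0 = int (length u) * letter_sign a"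
    and "coeff (sign_poly v) 0 = int (length v) * letter_sign (a + 1)"
    using assms(1) by (cases a; simp)+
  then have uv: "u = replicate (Suc (length v)) a" "v = replicate (length v) (a + 1)"
    using assms(1) coeff_sign_poly_0_extremal by metis+
  have "tm_word (replicate (Suc n) a) = (tm_word (replicate n a) @ [a]) @ [a + 1]" for n
    by (simp only: replicate_Suc replicate_append_same[symmetric] morph_word_simps thue_morse_eq)
      simp
  then show ?thesis using tm_word_replicate_shift[of "length v" a] ba uv by (metis append_Cons)
qed

text \<open>Different first letters would make the zeroth moments of \<open>u\<close> and
  \<open>v\<close> differ by \<open>2 * (2 * length v + 1)\<close>, while at most
  \<open>2 * length v\<close> is possible.\<close>

lemma tm_aligned_context:
  assumes "length u = length v"
    and "coeff (sign_poly (a # tm_word u @ [b])) 0 = coeff (sign_poly (a' # tm_word v @ [b'])) 0"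
    and "coeff (sign_poly (a # tm_word u @ [b])) 1 = coeff (sign_poly (a' # tm_word v @ [b'])) 1"
  shows "a = a'" "b = b'"
proof -
  let ?n = "int (length v)"
  have ab: "letter_sign a + letter_sign b = letter_sign a' + letter_sign b'"
    using assms(2) coeff_0_append[of "[a]" "tm_word u @ [b]"] coeff_0_append[of "[a']" "tm_word v @ [b']"]
    by (simp add: coeff_tm_word)
  have "coeff (sign_poly u) 0 + (2 * ?n + 1) * letter_sign a
      = coeff (sign_poly v) 0 + (2 * ?n + 1) * letter_sign a'"
    using assms(1,3) coeff_1_append[of "[a]" "tm_word u @ [b]"] coeff_1_append[of "tm_word u" "[b]"]
      coeff_1_append[of "[a']" "tm_word v @ [b']"] coeff_1_append[of "tm_word v" "[b']"]
    by (simp add: coeff_tm_word algebra_simps)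
  moreover have "\<bar>coeff (sign_poly u) 0\<bar> \<le> ?n" "\<bar>coeff (sign_poly v) 0\<bar> \<le> ?n"
    using abs_coeff_sign_poly_0_le[of u] abs_coeff_sign_poly_0_le[of v] assms(1) by simp_all
  ultimately show "a = a'" by (cases a; cases a') simp_all
  then show "b = b'" using ab by simp
qed

text \<open>The length fixes the parity of the number of cut-off letters. Equal cuts lead to equal
  contexts; different cuts are the misaligned cases, where the words agree.\<close>

lemma tm_desubstitution:
  assumes lens: "length p \<le> 1" "length s \<le> 1" "length p' \<le> 1" "length s' \<le> 1"
    and len: "length (p @ tm_word u @ s) = length (p' @ tm_word v @ s')"
    and dvd: "monom 1 2 dvd sign_poly (p @ tm_word u @ s) - sign_poly (p' @ tm_word v @ s')"
  shows "p @ tm_word u @ s = p' @ tm_word v @ s' \<or> p = p' \<and> s = s' \<and> length u = length v"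
proof -
  have c: "coeff (sign_poly (p @ tm_word u @ s)) 0 = coeff (sign_poly (p' @ tm_word v @ s')) 0"
    "coeff (sign_poly (p @ tm_word u @ s)) 1 = coeff (sign_poly (p' @ tm_word v @ s')) 1"
    using dvd unfolding monom_1_dvd_iff' by (simp_all del: coeff_0_append)
  have par: "2 * m = Suc (2 * n) \<longleftrightarrow> False" "Suc (2 * m) = 2 * n \<longleftrightarrow> False" for m n :: nat
    by presburger+
  have even: "Suc (Suc (2 * m)) = 2 * n \<longleftrightarrow> n = Suc m" "2 * n = Suc (Suc (2 * m)) \<longleftrightarrow> n = Suc m"
    for m n :: nat by presburger+
  have short: "w = [] \<or> (\<exists>a. w = [a])" if "length w \<le> 1" for w :: "bit list"
    using that by (cases w) auto
  have p': "p' = [] \<or> (\<exists>a. p' = [a])" and s': "s' = [] \<or> (\<exists>a. s' = [a])"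
    using lens short by blast+
  consider "p = []" "s = []" | b where "p = []" "s = [b]" | a where "p = [a]" "s = []"
    | a b where "p = [a]" "s = [b]"
    using short[OF lens(1)] short[OF lens(2)] by blast
  then show ?thesis
  proof cases
    case 1
    then show ?thesis
      using p' s' len c tm_misaligned_even[of u v]
      by (elim disjE exE) (auto simp: par even)
  next
    case (2 b)
    then show ?thesis
      using p' s' len c tm_misaligned_odd[of u v b]
      by (elim disjE exE) (auto simp: par even coeff_tm_word)
  next
    case (3 a)
    consider b' where "p' = []" "s' = [b']" "length v = length u"
      | a' where "p' = [a']" "s' = []" "length u = length v"
      using p' s' len 3 by (elim disjE exE) (simp_all add: par)
    then show ?thesis
    proof cases
      case (1 b')
      then show ?thesis
        using c 3 tm_misaligned_odd[of v u b' a] by simp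
    next
      case (2 a')
      then show ?thesis using c(1) 3 by (simp add: coeff_tm_word)
    qed
  next
    case (4 a b)
    consider "p' = []" "s' = []" "length v = Suc (length u)"
      | a' b' where "p' = [a']" "s' = [b']" "length u = length v"
      using p' s' len 4 by (elim disjE exE) (simp_all add: par even)
    then show ?thesis
    proof cases
      case 1
      then show ?thesis
        using c 4 tm_misaligned_even[of v u a b] by simp
    next
      case (2 a' b')
      then show ?thesis
        using c 4 tm_aligned_context[of u v a b a' b'] by simp
    qed
  qed
qed

section \<open>Factors as windows of an infinite word\<close>

definition window :: "(nat \<Rightarrow> 'a) \<Rightarrow> nat \<Rightarrow> nat \<Rightarrow> 'a list" where
  "window x i n = map x [i..<i + n]"

lemma length_window [simp]: "length (window x i n) = n"
  by (simp add: window_def)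

lemma nth_window [simp]: "t < n \<Longrightarrow> window x i n ! t = x (i + t)"
  by (simp add: window_def)

lemma factors_eq: "factors x n = range (\<lambda>i. window x i n)"
  by (auto simp: factors_def window_def)

lemma window_in_factors [simp]: "window x i n \<in> factors x n"
  by (simp add: factors_eq)

lemma window_eq_iff: "window x i n = window y j n \<longleftrightarrow> (\<forall>t<n. x (i + t) = y (j + t))"
  by (simp add: list_eq_iff_nth_eq)

lemma window_0 [simp]: "window x i 0 = []"
  by (simp add: window_def)

lemma window_Suc: "window x i (Suc n) = x i # window x (Suc i) n"
  unfolding window_def by (subst upt_conv_Cons) simp_all

lemma window_append: "window x i (m + n) = window x i m @ window x (i + m) n"
  unfolding window_def map_append[symmetric] add.assoc[symmetric]
  by (subst upt_add_eq_append) simp_all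

lemma window_Suc_right: "window x i (Suc n) = window x i n @ [x (i + n)]"
  unfolding window_def add_Suc_right by (subst upt_Suc_append) simp_all

section \<open>Sturmian words are balanced\<close>

text \<open>Every window equals one that starts before \<open>p + d\<close>, so there are at most
  \<open>p + d\<close> factors of length \<open>p + d\<close>.\<close>

lemma eventually_periodic_not_sturmian:
  assumes per: "\<And>t. x (p + d + t) = x (p + t)" and d: "d > 0"
  shows "\<not> sturmian x"
proof
  assume "sturmian x"
  have "\<exists>j<p + d. window x i n = window x j n" for i n
  proof (induction i rule: less_induct)
    case (less i)
    show ?case
    proof (cases "i < p + d")
      case False
      then obtain k where i: "i = p + d + k" by (metis le_Suc_ex not_less)
      have "window x i n = window x (i - d) n"
        using per[of "k + t" for t] by (simp add: i window_eq_iff add.assoc)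
      then show ?thesis using less[of "i - d"] False d by auto
    qed auto
  qed
  then have "factors x (p + d) \<subseteq> (\<lambda>i. window x i (p + d)) ` {..<p + d}"
    unfolding factors_eq by blast
  then have "card (factors x (p + d)) \<le> p + d"
    by (metis card_lessThan finite_lessThan surj_card_le)
  then show False using \<open>sturmian x\<close> by (simp add: sturmian_def)
qed

definition right_special :: "(nat \<Rightarrow> 'a) \<Rightarrow> 'a list \<Rightarrow> bool" where
  "right_special x r \<longleftrightarrow>
    (\<exists>i j. window x i (length r) = r \<and> window x j (length r) = r \<and> x (i + length r) \<noteq> x (j + length r))"

lemma sturmian_finite_factors: "sturmian x \<Longrightarrow> finite (factors x n)"
  by (metis add_is_0 card.infinite one_neq_zero sturmian_def)

text \<open>Every factor has a chosen extension \<open>ext w\<close>, a right special one also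
  another. Two special factors would yield \<open>length r + 3\<close> factors of length
  \<open>length r + 1\<close>.\<close>

lemma sturmian_right_special_unique:
  assumes st: "sturmian x" and rs: "right_special x r" "right_special x r'"
    and len: "length r' = length r"
  shows "r = r'"
proof (rule ccontr)
  assume ne: "r \<noteq> r'"
  let ?n = "length r"
  define pos where "pos w = (SOME i. window x i ?n = w)" for w
  define ext where "ext w = window x (pos w) (Suc ?n)" for w
  have pos: "window x (pos w) ?n = w" if "w \<in> factors x ?n" for w
    unfolding pos_def using that by (intro someI_ex[of "\<lambda>i. window x i ?n = w"]) (auto simp: factors_eq)
  have other: "\<exists>e \<in> factors x (Suc ?n). take ?n e = w \<and> e \<noteq> ext w"
    if rsw: "right_special x w" and lw: "length w = ?n" for w
  proof -
    obtain i j where ij: "window x i ?n = w" "window x j ?n = w" "x (i + ?n) \<noteq> x (j + ?n)"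
      using rsw unfolding right_special_def lw by blast
    then have "window x i (Suc ?n) \<noteq> ext w \<or> window x j (Suc ?n) \<noteq> ext w"
      unfolding ext_def window_Suc_right by auto
    moreover have "take ?n (window x i (Suc ?n)) = w" "take ?n (window x j (Suc ?n)) = w"
      using ij lw by (simp_all add: window_Suc_right)
    ultimately show ?thesis using window_in_factors[of x _ "Suc ?n"] by metis
  qed
  obtain e e' where e: "e \<in> factors x (Suc ?n)" "take ?n e = r" "e \<noteq> ext r"
    and e': "e' \<in> factors x (Suc ?n)" "take ?n e' = r'" "e' \<noteq> ext r'"
    using other[OF rs(1)] other[OF rs(2) len] by auto
  have take_ext: "take ?n (ext w) = w" if "w \<in> factors x ?n" for w
    using pos[OF that] by (metis append_eq_conv_conj ext_def length_window window_Suc_right)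
  have inj: "inj_on ext (factors x ?n)"
    by (metis inj_onI take_ext)
  have "e \<notin> ext ` factors x ?n" "e' \<notin> ext ` factors x ?n" "e \<noteq> e'"
    using e e' take_ext ne by auto
  then have "card (insert e (insert e' (ext ` factors x ?n))) = ?n + 3"
    using st inj by (simp add: card_image sturmian_finite_factors sturmian_def)
  moreover have "insert e (insert e' (ext ` factors x ?n)) \<subseteq> factors x (Suc ?n)"
    using e(1) e'(1) by (auto simp: ext_def)
  then have "card (insert e (insert e' (ext ` factors x ?n))) \<le> card (factors x (Suc ?n))"
    by (rule card_mono[OF sturmian_finite_factors[OF st]])
  ultimately show False using st by (simp add: sturmian_def)
qed

text \<open>Without a right special window from \<open>p\<close> to \<open>q\<close> each window
  determines the next, so the word repeats with period \<open>q - p\<close> from there on.\<close>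

lemma sturmian_right_special_recurs:
  assumes st: "sturmian x" and pq: "p < q" and eq: "window x p m = window x q m"
  shows "\<exists>i\<in>{p..<q}. right_special x (window x i m)"
proof (rule ccontr)
  assume "\<not> ?thesis"
  then have no: "\<not> right_special x (window x i m)" if "p \<le> i" "i < q" for i
    using that by auto
  have "window x (p + t) m = window x (q + t) m \<and> \<not> right_special x (window x (p + t) m)" for t
  proof (induction t rule: less_induct)
    case (less t)
    have "window x (p + t) m = window x (q + t) m"
    proof (cases t)
      case (Suc t')
      have IH: "window x (p + t') m = window x (q + t') m"
        "\<not> right_special x (window x (p + t') m)" using less[of t'] Suc by auto
      then have "x (p + t' + m) = x (q + t' + m)"
        unfolding right_special_def by (metis length_window)
      then have "window x (p + t') (Suc m) = window x (q + t') (Suc m)"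
        using IH by (simp add: window_Suc_right)
      then show ?thesis by (simp add: window_Suc Suc)
    qed (simp add: eq)
    moreover have "\<not> right_special x (window x (p + t) m)"
    proof (cases "p + t < q")
      case False
      then obtain t' where t': "p + t = q + t'" by (metis le_Suc_ex not_less)
      then have "t' < t" using pq by simp
      then show ?thesis using less[of t'] t' by metis
    qed (simp add: no)
    ultimately show ?case by simp
  qed
  then have "x (p + t + m) = x (q + t + m)" for t
    unfolding right_special_def by (metis length_window)
  moreover have "p + m + (q - p) + t = q + t + m" "p + m + t = p + t + m" for t
    using pq by simp_all
  ultimately have "x (p + m + (q - p) + t) = x (p + m + t)" for t
    by metis
  then show False using eventually_periodic_not_sturmian[of x "p + m" "q - p"] st pq by simp
qed

text \<open>With \<open>w\<close> the palindrome common to both windows, \<open>a = x i\<close> and \<open>b = x j\<close>, the words \<open>awa\<close>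
  and \<open>bwb\<close> are factors. If \<open>aw\<close> is not right special, then the only right special factor of its
  length is \<open>bw\<close>, and as \<open>w\<close> is a palindrome, \<open>bw\<close> does not occur in the \<open>n + 2\<close> windows
  starting in \<open>awa\<close>; so one of the other \<open>n + 1\<close> factors of that length occurs twice there.\<close>

lemma sturmian_palindrome_extension_special:
  assumes st: "sturmian x"
    and ends: "x (i + n + 1) = x i" "x j \<noteq> x i" "x (j + n + 1) \<noteq> x i"
    and common: "\<And>t. 1 \<le> t \<Longrightarrow> t \<le> n \<Longrightarrow> x (i + t) = x (j + t)"
    and palin: "\<And>t. 1 \<le> t \<Longrightarrow> t \<le> n \<Longrightarrow> x (i + t) = x (i + (n + 1 - t))"
  shows "right_special x (window x i (Suc n))"
proof (rule ccontr)
  assume nrs: "\<not> right_special x (window x i (Suc n))"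
  let ?w = "window x (Suc i) n"
  have w': "window x (Suc j) n = ?w"
    unfolding window_eq_iff using common[of "Suc t" for t] by auto
  have "right_special x ?w"
    unfolding right_special_def length_window
    using ends w' by (intro exI[of _ "Suc i"] exI[of _ "Suc j"]) auto
  have special: "window x l (Suc n) = window x j (Suc n)"
    if "right_special x (window x l (Suc n))" for l
  proof -
    have tl: "right_special x (tl (window x l (Suc n)))"
    proof -
      obtain a b where "window x a (Suc n) = window x l (Suc n)"
        "window x b (Suc n) = window x l (Suc n)" "x (a + Suc n) \<noteq> x (b + Suc n)"
        using \<open>right_special x (window x l (Suc n))\<close> unfolding right_special_def length_window by blast
      then show ?thesis unfolding right_special_def
        by (intro exI[of _ "Suc a"] exI[of _ "Suc b"]) (auto simp: window_Suc)
    qed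
    then have "right_special x (window x (Suc l) n)" by (simp add: window_Suc)
    from sturmian_right_special_unique[OF st this \<open>right_special x ?w\<close>]
    have lw: "window x (Suc l) n = ?w" by simp
    show ?thesis
    proof (rule ccontr)
      assume ne: "window x l (Suc n) \<noteq> window x j (Suc n)"
      have "x l \<noteq> x i" using that nrs lw by (auto simp: window_Suc)
      moreover have "x l \<noteq> x j" using ne lw w' by (auto simp: window_Suc)
      moreover have "card {x l, x i, x j} \<le> card (factors x 1)"
      proof (rule surj_card_le[where f = hd])
        show "finite (factors x 1)" by (rule sturmian_finite_factors[OF st])
        have "hd (window x a 1) = x a" for a by (simp add: window_Suc)
        then show "{x l, x i, x j} \<subseteq> hd ` factors x 1"
          by (auto simp: factors_eq image_iff)
      qed
      moreover have "card (factors x 1) = 2" using st by (simp add: sturmian_def)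
      ultimately show False using ends(2) by auto
    qed
  qed
  have avoid: "window x (i + r) (Suc n) \<noteq> window x j (Suc n)" if r: "r \<le> Suc n" for r
  proof
    assume "window x (i + r) (Suc n) = window x j (Suc n)"
    then have wr: "x (i + r) = x j" "window x (Suc (i + r)) n = ?w"
      using w' by (simp_all add: window_Suc)
    have "r \<noteq> 0" using wr(1) ends(2) by (metis add_0_right)
    moreover have "r \<noteq> Suc n" using wr(1) ends(1,2) by auto
    ultimately have r1: "1 \<le> r" "r \<le> n" using r by auto
    then have "n - r < n" by simp
    \<comment> \<open>Position \<open>i + n + 1\<close> lies in the copy of the palindrome that
      starts at \<open>Suc (i + r)\<close>. Its letter there is the mirror image of
      \<open>x (i + r) = x j\<close>, although it equals \<open>x i\<close>.\<close>
    then have "x (Suc (i + r) + (n - r)) = x (Suc i + (n - r))"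
      using wr(2) unfolding window_eq_iff by blast
    moreover have "Suc (i + r) + (n - r) = i + n + 1" "Suc i + (n - r) = i + (n + 1 - r)"
      using r1 by simp_all
    ultimately have "x (i + n + 1) = x (i + (n + 1 - r))" by metis
    also have "\<dots> = x (i + r)" using palin r1 by simp
    finally show False using wr(1) ends by simp
  qed
  have "\<not> inj_on (\<lambda>r. window x (i + r) (Suc n)) {..Suc n}"
  proof
    assume "inj_on (\<lambda>r. window x (i + r) (Suc n)) {..Suc n}"
    then have "card ((\<lambda>r. window x (i + r) (Suc n)) ` {..Suc n}) = n + 2"
      by (simp add: card_image)
    moreover have "(\<lambda>r. window x (i + r) (Suc n)) ` {..Suc n} \<subseteq> factors x (Suc n) - {window x j (Suc n)}"
      using avoid by auto
    then have "card ((\<lambda>r. window x (i + r) (Suc n)) ` {..Suc n}) \<le> card (factors x (Suc n) - {window x j (Suc n)})"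
      using sturmian_finite_factors[OF st] by (intro card_mono) auto
    moreover have "card (factors x (Suc n) - {window x j (Suc n)}) = n + 1"
      using st sturmian_finite_factors[OF st] by (simp add: card_Diff_singleton sturmian_def)
    ultimately show False by simp
  qed
  then obtain r r' where "r < r'" "r' \<le> Suc n" "window x (i + r) (Suc n) = window x (i + r') (Suc n)"
    unfolding inj_on_def by (metis atMost_iff nat_neq_iff)
  \<comment> \<open>A right special window recurs between the two; by \<open>special\<close> it
    equals the window at \<open>j\<close>, which \<open>avoid\<close> excludes.\<close>
  then obtain l where "i + r \<le> l" "l < i + r'" "right_special x (window x l (Suc n))"
    using sturmian_right_special_recurs[OF st, of "i + r" "i + r'" "Suc n"] by auto
  moreover from this have "l = i + (l - i)" "l - i \<le> Suc n" using \<open>r' \<le> Suc n\<close> by simp_all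
  ultimately show False using special[of l] avoid[of "l - i"] by metis
qed

definition ones :: "(nat \<Rightarrow> bit) \<Rightarrow> nat \<Rightarrow> nat \<Rightarrow> int" where
  "ones x i n = (\<Sum>t<n. of_bool (x (i + t) = 1))"

lemma ones_0 [simp]: "ones x i 0 = 0"
  by (simp add: ones_def)

lemma ones_Suc: "ones x i (Suc n) = ones x i n + of_bool (x (i + n) = 1)"
  by (simp add: ones_def)

lemma ones_add: "ones x i (m + n) = ones x i m + ones x (i + m) n"
  by (induction n) (simp_all add: ones_Suc add.assoc)

lemma ones_Suc_left: "ones x i (Suc n) = of_bool (x i = 1) + ones x (Suc i) n"
  using ones_add[of x i 1 n] by (simp add: ones_Suc)

lemma ones_split: "m \<le> n \<Longrightarrow> ones x i n = ones x i m + ones x (i + m) (n - m)"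
  using ones_add[of x i m "n - m"] by simp

lemma ones_cong: "(\<And>t. t < n \<Longrightarrow> x (i + t) = x (j + t)) \<Longrightarrow> ones x i n = ones x j n"
  by (simp add: ones_def)

text \<open>A shortest violation consists of 1w1 and 0w0, and minimality makes w a palindrome. Then
  1w and 0w are both right special, against uniqueness.\<close>

lemma sturmian_balanced:
  fixes x :: "nat \<Rightarrow> bit"
  assumes st: "sturmian x"
  shows "\<bar>ones x i n - ones x j n\<bar> \<le> 1"
proof (rule ccontr)
  define P where "P m \<longleftrightarrow> (\<exists>i j. ones x i m \<ge> ones x j m + 2)" for m
  assume "\<not> ?thesis"
  then have "ones x i n \<ge> ones x j n + 2 \<or> ones x j n \<ge> ones x i n + 2" by linarith
  then have "P n" unfolding P_def by blast
  then have "P (LEAST m. P m)" by (rule LeastI)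
  moreover have min: "ones x i m \<le> ones x j m + 1" if "m < (LEAST m. P m)" for i j m
    using not_less_Least[OF that] unfolding P_def by (metis add.assoc not_le one_add_one zless_add1_eq
        order_less_le add1_zle_eq)
  moreover define N where "N = (LEAST m. P m)"
  ultimately obtain i j where big: "ones x i N \<ge> ones x j N + 2"
    and min: "\<And>i j m. m < N \<Longrightarrow> ones x i m \<le> ones x j m + 1"
    unfolding P_def by auto
  have "N \<noteq> 0" using big by (cases N) simp_all
  moreover have "N \<noteq> Suc 0"
    using big by (cases "N = Suc 0") (auto simp: ones_Suc of_bool_def split: if_splits)
  ultimately obtain n where N: "N = Suc (Suc n)" by (metis not0_implies_Suc)
  \<comment> \<open>Cut at \<open>t\<close>, both parts have excess at most 1 by minimality, and the
    whole has excess at least 2.\<close>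
  have one: "ones x i t = ones x j t + 1" if "1 \<le> t" "t \<le> Suc n" for t
    using that big min[of t i j] min[of "N - t" "i + t" "j + t"]
      ones_split[of t N x i] ones_split[of t N x j] by (simp add: N)
  have ends: "x i = 1" "x j = 0" "x (i + n + 1) = 1" "x (j + n + 1) = 0"
    using one[of 1] one[of "Suc n"] big unfolding N
    by (auto simp: ones_Suc of_bool_def split: if_splits)
  have common: "x (i + t) = x (j + t)" if "1 \<le> t" "t \<le> n" for t
    using one[of t] one[of "Suc t"] that
    by (cases "x (i + t)"; cases "x (j + t)") (simp_all add: ones_Suc)
  \<comment> \<open>For the prefix u and the suffix v of length \<open>t\<close> of the common word,
    minimality compares 1u with v0 and v1 with 0u, so u and v contain equally many ones.\<close>
  have pal: "ones x (Suc i) t = ones x (i + (n + 1 - t)) t" if "t \<le> n" for t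
  proof -
    have eq: "ones x (j + a) t = ones x (i + a) t" if "1 \<le> a" "a + t \<le> n + 1" for a
      using common[of "a + l" for l] that by (intro ones_cong) (simp add: add.assoc)
    define a where "a = n + 1 - t"
    have a: "1 \<le> a" "a + t = n + 1" using that by (simp_all add: a_def)
    have last: "x (i + a + t) = 1" "x (j + a + t) = 0"
      using ends a(2) by (simp_all add: add.assoc)
    have "ones x i (Suc t) = 1 + ones x (Suc i) t" "ones x j (Suc t) = ones x (Suc j) t"
      using ends by (simp_all add: ones_Suc_left)
    moreover have "ones x (i + a) (Suc t) = ones x (i + a) t + 1"
      "ones x (j + a) (Suc t) = ones x (j + a) t"
      using last by (simp_all add: ones_Suc)
    moreover have "ones x i (Suc t) \<le> ones x (j + a) (Suc t) + 1"
      "ones x (i + a) (Suc t) \<le> ones x j (Suc t) + 1"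
      using that by (auto intro!: min simp: N)
    moreover have "ones x (Suc j) t = ones x (Suc i) t" "ones x (j + a) t = ones x (i + a) t"
      using eq[of 1] eq[of a] a that by simp_all
    ultimately show ?thesis unfolding a_def[symmetric] by linarith
  qed
  have palin: "x (i + t) = x (i + (n + 1 - t))" if t1: "1 \<le> t" and tn: "t \<le> n" for t
  proof -
    obtain t' where t: "t = Suc t'" using t1 by (cases t) auto
    have "ones x (Suc i) (Suc t') = ones x (i + (n - t')) (Suc t')"
      "ones x (Suc i) t' = ones x (Suc (i + (n - t'))) t'"
      using pal[of t] pal[of t'] tn by (simp_all add: t Suc_diff_le)
    then have "of_bool (x (i + t) = 1) = (of_bool (x (i + (n + 1 - t)) = 1) :: int)"
      using ones_Suc[of x "Suc i" t'] ones_Suc_left[of x "i + (n - t')" t'] by (simp add: t)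
    then show ?thesis by (cases "x (i + t)"; cases "x (i + (n + 1 - t))") simp_all
  qed
  have "right_special x (window x i (Suc n))"
    using ends common palin by (intro sturmian_palindrome_extension_special[OF st, of i n j]) auto
  moreover have "x (j + t) = x (j + (n + 1 - t))" if "1 \<le> t" "t \<le> n" for t
    using palin[OF that] common[OF that] common[of "n + 1 - t"] that by simp
  then have "right_special x (window x j (Suc n))"
    using ends common by (intro sturmian_palindrome_extension_special[OF st, of j n i]) auto
  ultimately have "window x i (Suc n) = window x j (Suc n)"
    using sturmian_right_special_unique[OF st] by simp
  then show False using ends by (simp add: window_Suc)
qed

section \<open>Moments of Sturmian factors\<close>

lemma coeff_0_window: "coeff (sign_poly (window x i n)) 0 = int n - 2 * ones x i n"
proof (induction n)
  case (Suc n)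
  then show ?case by (cases "x (i + n)") (simp_all add: window_Suc_right ones_Suc)
qed simp

text \<open>A letter is weighted by the number of letters after it, which is the number of proper
  prefixes that contain it.\<close>

lemma coeff_1_window:
  "coeff (sign_poly (window x i n)) 1 = (\<Sum>m<n. coeff (sign_poly (window x i m)) 0)"
proof (induction n)
  case (Suc n)
  then show ?case using coeff_1_append[of "window x i n" "[x (i + n)]"]
    by (simp add: window_Suc_right)
qed simp

text \<open>The difference of the heights of two windows cannot take both signs, by balance; having mean
  zero, it vanishes.\<close>

lemma sturmian_window_determined:
  fixes x :: "nat \<Rightarrow> bit"
  assumes st: "sturmian x"
    and dvd: "monom 1 2 dvd sign_poly (window x i n) - sign_poly (window x j n)"
  shows "window x i n = window x j n"
proof -
  define h where "h m = ones x i m - ones x j m" for m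
  have c: "coeff (sign_poly (window x i n)) 0 = coeff (sign_poly (window x j n)) 0"
    "coeff (sign_poly (window x i n)) 1 = coeff (sign_poly (window x j n)) 1"
    using dvd unfolding monom_1_dvd_iff' by simp_all
  have hn: "h n = 0" using c(1) by (simp add: coeff_0_window h_def)
  have "(\<Sum>m<n. int m - 2 * ones x i m) = (\<Sum>m<n. int m - 2 * ones x j m)"
    using c(2) unfolding coeff_1_window coeff_0_window .
  then have sum: "(\<Sum>m<n. h m) = 0"
    by (simp add: h_def sum_subtractf flip: sum_distrib_left)
  have diff: "\<bar>h m' - h m\<bar> \<le> 1" if "m \<le> m'" for m m'
    using sturmian_balanced[OF st, of "i + m" "m' - m" "j + m"]
      ones_split[OF that, of x i] ones_split[OF that, of x j] by (simp add: h_def)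
  have sign: "\<not> (h m > 0 \<and> h m' < 0)" for m m'
    using diff[of m m'] diff[of m' m] by (cases "m \<le> m'") auto
  have "h m = 0" if "m < n" for m
  proof (cases "\<exists>m. h m > 0")
    case True
    then have "\<forall>m. h m \<ge> 0" using sign by (meson not_le)
    then show ?thesis using sum that by (simp add: sum_nonneg_eq_0_iff)
  next
    case False
    then have "\<forall>m. h m \<le> 0" by (meson not_le)
    then have "(\<Sum>m<n. - h m) = 0" "\<forall>m. - h m \<ge> 0" using sum by (simp_all add: sum_negf)
    then show ?thesis using that by (simp only: sum_nonneg_eq_0_iff finite_lessThan) simp
  qed
  then have h0: "h m = 0" if "m \<le> n" for m using that hn by (cases "m = n") auto
  show ?thesis unfolding window_eq_iff
  proof (intro allI impI)
    fix t assume "t < n"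
    then have "h t = 0" "h (Suc t) = 0" using h0 by auto
    then show "x (i + t) = x (j + t)"
      by (cases "x (i + t)"; cases "x (j + t)") (simp_all add: h_def ones_Suc)
  qed
qed

lemma binomial_equiv_1_if_coeff_0_eq:
  assumes "length u = length v" and "coeff (sign_poly u) 0 = coeff (sign_poly v) 0"
  shows "(u, v) \<in> binomial_equiv 1"
proof -
  have wb: "2 * int (word_binomial u [d]) = int (length u) + letter_sign d * coeff (sign_poly u) 0"
    for u and d :: bit
  proof (induction u)
    case (Cons c u)
    then show ?case
      by (cases c; cases d) (simp_all add: word_binomial_Cons_Cons)
  qed (simp add: word_binomial_Nil_left)
  have "word_binomial u [d] = word_binomial v [d]" for d
    using wb[of u d] wb[of v d] assms by simp
  then have "word_binomial u y = word_binomial v y" if "length y \<le> 1" for y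
    using that by (cases y) auto
  then show ?thesis by (simp add: binomial_equiv_def)
qed

text \<open>By balance the zeroth moment takes at most two values on the
  \<open>n + 1 \<ge> 3\<close> factors.\<close>

lemma sturmian_abelian_equivalent_windows:
  fixes x :: "nat \<Rightarrow> bit"
  assumes st: "sturmian x" and n: "n \<ge> 2"
  obtains i j where "window x i n \<noteq> window x j n"
    and "(window x i n, window x j n) \<in> binomial_equiv 1"
proof -
  let ?f = "\<lambda>u. coeff (sign_poly u) 0"
  obtain m where m: "\<And>i. ones x i n \<in> {m, m + 1}"
  proof (cases "\<exists>i. ones x i n = ones x 0 n - 1")
    case True
    then obtain i where "ones x i n = ones x 0 n - 1" by blast
    moreover have "\<bar>ones x i' n - ones x i n\<bar> \<le> 1" "\<bar>ones x i' n - ones x 0 n\<bar> \<le> 1" for i'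
      by (rule sturmian_balanced[OF st])+
    ultimately have "ones x i' n \<in> {ones x i n, ones x i n + 1}" for i'
      by (smt (verit) insertCI)
    then show ?thesis using that by blast
  next
    case False
    have "ones x i n \<in> {ones x 0 n, ones x 0 n + 1}" for i
      using sturmian_balanced[OF st, of i n 0] False by (smt (verit) insertCI)
    then show ?thesis using that by blast
  qed
  have "?f (window x i n) \<in> {int n - 2 * m, int n - 2 * (m + 1)}" for i
    using m[of i] by (auto simp: coeff_0_window)
  then have "?f ` factors x n \<subseteq> {int n - 2 * m, int n - 2 * (m + 1)}"
    unfolding factors_eq by blast
  then have "card (?f ` factors x n) \<le> card {int n - 2 * m, int n - 2 * (m + 1)}"
    by (intro card_mono) auto
  then have "card (?f ` factors x n) < card (factors x n)"
    using st n by (simp add: sturmian_def)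
  then have "\<not> inj_on ?f (factors x n)" by (rule pigeonhole)
  then obtain i j where "window x i n \<noteq> window x j n" "?f (window x i n) = ?f (window x j n)"
    unfolding inj_on_def factors_eq by auto
  then show thesis using that[of i j] binomial_equiv_1_if_coeff_0_eq by simp
qed

section \<open>Iterated images of Sturmian words\<close>

lemma morph_image_nth:
  assumes "n < length (morph_word h (window x 0 m))"
  shows "morph_image h x n = morph_word h (window x 0 m) ! n"
proof -
  let ?P = "\<lambda>m. n < length (morph_word h (window x 0 m))"
  define M where "M = (LEAST m. ?P m)"
  have "?P M" unfolding M_def using assms by (rule LeastI)
  moreover have "M \<le> m" unfolding M_def using assms by (rule Least_le)
  then have "window x 0 m = window x 0 M @ window x M (m - M)"
    using window_append[of x 0 M "m - M"] by simp
  ultimately show ?thesis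
    by (simp add: morph_image_def nth_append M_def window_def)
qed

lemma tm_image_nth:
  "morph_image thue_morse x (2 * n) = x n"
  "morph_image thue_morse x (Suc (2 * n)) = x n + 1"
proof -
  have w: "tm_word (window x 0 (Suc n)) = tm_word (window x 0 n) @ [x n, x n + 1]"
    by (simp add: window_Suc_right thue_morse_eq[of "x n"])
  have "2 * n < length (tm_word (window x 0 (Suc n)))"
    "Suc (2 * n) < length (tm_word (window x 0 (Suc n)))" by simp_all
  then show "morph_image thue_morse x (2 * n) = x n"
    "morph_image thue_morse x (Suc (2 * n)) = x n + 1"
    using morph_image_nth[of _ thue_morse x "Suc n"] w by (simp_all add: nth_append del: morph_word_simps)
qed

lemma window_tm_image:
  "window (morph_image thue_morse x) (2 * i) (2 * n) = tm_word (window x i n)"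
proof (induction n)
  case (Suc n)
  have "2 * i + 2 * n = 2 * (i + n)" by simp
  then show ?case using Suc
    by (simp add: window_Suc_right thue_morse_eq[of "x (i + n)"] tm_image_nth del: mult_Suc_right
        distrib_left_numeral add: mult_Suc_right[of 2 n])
qed simp

lemma thue_morse_iterate_simps:
  "thue_morse_iterate 0 x = x"
  "thue_morse_iterate (Suc k) x = morph_image thue_morse (thue_morse_iterate k x)"
  "thue_morse_iterate (j + k) x = thue_morse_iterate j (thue_morse_iterate k x)"
  by (simp_all add: thue_morse_iterate_def funpow_add)

lemma window_thue_morse_iterate:
  "window (thue_morse_iterate t x) (2 ^ t * i) (2 ^ t * n) = (tm_word ^^ t) (window x i n)"
  by (induction t) (simp_all add: thue_morse_iterate_simps mult.assoc window_tm_image)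

lemma tm_image_window_even:
  "\<exists>s. length s \<le> 1 \<and>
    window (morph_image thue_morse x) (2 * i) n = tm_word (window x i (n div 2)) @ s"
proof (cases "even n")
  case True
  then show ?thesis using window_tm_image[of x i "n div 2"] by auto
next
  case False
  then have "n = Suc (2 * (n div 2))" by presburger
  then show ?thesis
    by (metis window_tm_image window_Suc_right length_Cons list.size(3) One_nat_def le_refl)
qed

lemma tm_image_factor:
  assumes "U \<in> factors (morph_image thue_morse x) n"
  obtains p i m s where "U = p @ tm_word (window x i m) @ s" "length p \<le> 1" "length s \<le> 1"
proof -
  let ?y = "morph_image thue_morse x"
  obtain a where U: "U = window ?y a n" using assms by (auto simp: factors_eq)
  show thesis
  proof (cases "even a")
    case True
    then obtain i where a: "a = 2 * i" by blast
    then show ?thesis using tm_image_window_even[of x i n] that[of "[]"] U by auto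
  next
    case False
    then obtain i where a: "Suc a = 2 * i" by (metis evenE even_Suc)
    show ?thesis
    proof (cases n)
      case 0
      then show ?thesis using that[of "[]" 0 0 "[]"] U by simp
    next
      case (Suc m)
      then show ?thesis using tm_image_window_even[of x i m] that[of "[?y a]"] U a
        by (auto simp: window_Suc)
    qed
  qed
qed

text \<open>If desubstitution does not give equality at once, the contexts agree; cancelling them
  lowers the order by one and leaves factors of the preceding iterate.\<close>

lemma thue_morse_iterate_factor_determined:
  assumes st: "sturmian x"
    and "U \<in> factors (thue_morse_iterate k x) n" "V \<in> factors (thue_morse_iterate k x) n"
    and "monom 1 (k + 2) dvd sign_poly U - sign_poly V"
  shows "U = V"
  using assms(2-)
proof (induction k arbitrary: U V n)
  case 0
  then show ?case
    using sturmian_window_determined[OF st]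
    by (auto simp: thue_morse_iterate_simps factors_eq numeral_2_eq_2)
next
  case (Suc k)
  let ?y = "thue_morse_iterate k x"
  obtain p i m s where U: "U = p @ tm_word (window ?y i m) @ s" "length p \<le> 1" "length s \<le> 1"
    using Suc.prems(1) unfolding thue_morse_iterate_simps by (rule tm_image_factor)
  obtain p' i' m' s' where V: "V = p' @ tm_word (window ?y i' m') @ s'" "length p' \<le> 1" "length s' \<le> 1"
    using Suc.prems(2) unfolding thue_morse_iterate_simps by (rule tm_image_factor)
  have "length U = length V" using Suc.prems(1,2) by (auto simp: factors_eq)
  moreover have "monom 1 2 dvd sign_poly U - sign_poly V"
    using Suc.prems(3) by (auto simp: monom_1_dvd_iff')
  ultimately consider "U = V" | "p = p'" "s = s'" "m = m'"
    using tm_desubstitution[of p s p' s' "window ?y i m" "window ?y i' m'"] U V by auto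
  then show ?case
  proof cases
    case 2
    have "monom 1 (k + 2) dvd sign_poly (window ?y i m) - sign_poly (window ?y i' m')"
      using Suc.prems(3) dvd_sign_poly_context_cancel[of "k + 2" p "window ?y i m" s "window ?y i' m'"] U V 2
      by simp
    then have "window ?y i m = window ?y i' m'"
      using Suc.IH[of "window ?y i m" m "window ?y i' m'"] 2 by simp
    then show ?thesis using U V 2 by simp
  qed
qed

text \<open>A period \<open>n\<close> of the image is also a period \<open>2 * n\<close>, and the
  even positions carry the preceding word, to which the period \<open>n\<close> would pass.\<close>

lemma thue_morse_iterate_aperiodic:
  assumes "sturmian x" "n > 0"
  shows "\<exists>i. thue_morse_iterate k x (i + n) \<noteq> thue_morse_iterate k x i"
  using assms(2)
proof (induction k arbitrary: n)
  case 0
  then show ?case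
    using eventually_periodic_not_sturmian[of x 0 n] assms(1)
    by (auto simp: thue_morse_iterate_simps add.commute)
next
  case (Suc k)
  let ?y = "thue_morse_iterate k x" and ?z = "thue_morse_iterate (Suc k) x"
  obtain i where "?y (i + n) \<noteq> ?y i" using Suc by blast
  then have "?z (2 * i + n + n) \<noteq> ?z (2 * i)"
    using tm_image_nth(1)[of ?y i] tm_image_nth(1)[of ?y "i + n"]
    by (simp add: thue_morse_iterate_simps mult_2 add_ac)
  then show ?case by metis
qed

section \<open>Comparison of binomial complexities\<close>

text \<open>Closing under \<open>S\<close> maps the \<open>R\<close>-classes onto the
  \<open>S\<close>-classes and identifies those of \<open>u\<close> and \<open>v\<close>.\<close>

lemma card_quotient_less:
  assumes "finite A" "equiv UNIV R" "equiv UNIV S" "R \<subseteq> S"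
    and "u \<in> A" "v \<in> A" "(u, v) \<in> S" "(u, v) \<notin> R"
  shows "card (A // S) < card (A // R)"
proof -
  have fin: "finite (A // R)" using assms(1) by (simp add: quotient_def)
  have S: "S `` (R `` {a}) = S `` {a}" for a
    using assms(2-4) by (auto simp: equiv_def refl_on_def dest: transD)
  have img: "(\<lambda>C. S `` C) ` (A // R) = A // S"
    by (auto simp: quotient_def image_iff S)
  have "\<not> inj_on (\<lambda>C. S `` C) (A // R)"
  proof
    assume "inj_on (\<lambda>C. S `` C) (A // R)"
    moreover have "S `` (R `` {u}) = S `` (R `` {v})"
      unfolding S using assms(3,7) by (rule equiv_class_eq)
    ultimately have "R `` {u} = R `` {v}"
      by (rule inj_onD) (use assms(5,6) in \<open>auto intro: quotientI\<close>)
    then show False using assms(2,8) eq_equiv_class by fast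
  qed
  then show ?thesis
    using fin card_image_le[OF fin, of "\<lambda>C. S `` C"] eq_card_imp_inj_on[OF fin] img
    by (metis le_neq_implies_less)
qed

lemma finite_factors: "finite (factors (x :: nat \<Rightarrow> bit) n)"
proof (rule finite_subset)
  have "(UNIV :: bit set) = {0, 1}" using bit_not_zero_iff by blast
  then have "finite (UNIV :: bit set)" by (metis finite.emptyI finite.insertI)
  then show "finite {w :: bit list. set w \<subseteq> UNIV \<and> length w = n}" by (rule finite_lists_length_eq)
qed (auto simp: factors_eq)

lemma binomial_complexity_less:
  fixes x :: "nat \<Rightarrow> bit"
  assumes "u \<in> factors x n" "v \<in> factors x n"
    and "(u, v) \<in> binomial_equiv j" "(u, v) \<notin> binomial_equiv (j + 1)"
  shows "binomial_complexity j x n < binomial_complexity (j + 1) x n"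
  unfolding binomial_complexity_def
  using finite_factors equiv_binomial_equiv equiv_binomial_equiv binomial_equiv_mono[of j "j + 1"] assms
  by (intro card_quotient_less) auto

lemma inf_often_lessI:
  assumes "\<And>n. n \<ge> 2 \<Longrightarrow> f (2 ^ t * n) < g (2 ^ t * n)"
  shows "inf_often_less f g"
  unfolding inf_often_less_def infinite_nat_iff_unbounded_le
proof
  fix m :: nat
  have "m \<le> 2 ^ t * (m + 2)" by (metis le_add1 le_trans mult_le_mono1 nat_mult_1 one_le_numeral one_le_power)
  then show "\<exists>n\<ge>m. n \<in> {n. f n < g n}" using assms[of "m + 2"] by auto
qed

lemma sturmian_strict_binomial_chain:
  fixes s :: "nat \<Rightarrow> bit"
  assumes st: "sturmian s"
  shows "strict_binomial_chain k (thue_morse_iterate k s)"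
  unfolding strict_binomial_chain_def
proof (intro conjI ballI)
  let ?x = "thue_morse_iterate k s"
  have lift: "(tm_word ^^ t) (window (thue_morse_iterate (k - t) s) i n) \<in> factors ?x (2 ^ t * n)"
    if "t \<le> k" for t i n
    using that window_in_factors[of ?x "2 ^ t * i" "2 ^ t * n"]
      window_thue_morse_iterate[of t "thue_morse_iterate (k - t) s" i n]
    by (metis le_add_diff_inverse thue_morse_iterate_simps(3))
  fix j assume j: "j \<in> {1..k + 1}"
  show "inf_often_less (binomial_complexity j ?x) (binomial_complexity (j + 1) ?x)"
  proof (cases "j = k + 1")
    case True
    show ?thesis
    proof (rule inf_often_lessI[of _ k])
      fix n :: nat assume "n \<ge> 2"
      then obtain a b where ne: "window s a n \<noteq> window s b n"
        and eq: "(window s a n, window s b n) \<in> binomial_equiv 1"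
        by (rule sturmian_abelian_equivalent_windows[OF st])
      let ?u = "(tm_word ^^ k) (window s a n)" and ?v = "(tm_word ^^ k) (window s b n)"
      have "(?u, ?v) \<in> binomial_equiv j"
        using tm_word_iter_binomial_equiv[OF eq, of k] by (simp add: True)
      moreover have "(?u, ?v) \<notin> binomial_equiv (j + 1)"
      proof
        assume "(?u, ?v) \<in> binomial_equiv (j + 1)"
        then have "monom 1 (k + 2) dvd sign_poly ?u - sign_poly ?v"
          using binomial_equiv_imp_dvd_sign_poly True by fastforce
        then have "monom 1 2 dvd sign_poly (window s a n) - sign_poly (window s b n)"
          by (rule dvd_sign_poly_tm_word_iter) simp
        then show False using sturmian_window_determined[OF st] ne by blast
      qed
      ultimately show "binomial_complexity j ?x (2 ^ k * n) < binomial_complexity (j + 1) ?x (2 ^ k * n)"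
        using lift[of k a n] lift[of k b n] 
        by (intro binomial_complexity_less[of ?u _ _ ?v]) (simp_all add: thue_morse_iterate_simps)
    qed
  next
    case False
    then have jk: "j \<le> k" using j by simp
    let ?y = "thue_morse_iterate (k - j) s"
    show ?thesis
    proof (rule inf_often_lessI[of _ j])
      fix n :: nat assume "n \<ge> 2"
      then obtain a where a: "?y (a + n) \<noteq> ?y a"
        using thue_morse_iterate_aperiodic[OF st, of n "k - j"] by auto
      \<comment> \<open>Passing from \<open>a\<close> to \<open>Suc a\<close> replaces the letter
        \<open>?y a\<close> by \<open>?y (a + n)\<close>, so the two windows differ in the number of
        ones, while level 0 relates all words.\<close>
      let ?u = "(tm_word ^^ j) (window ?y a n)" and ?v = "(tm_word ^^ j) (window ?y (Suc a) n)"
      have "(window ?y a n, window ?y (Suc a) n) \<in> binomial_equiv 0"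
        by (simp add: binomial_equiv_def)
      then have "(?u, ?v) \<in> binomial_equiv j"
        using tm_word_iter_binomial_equiv[of _ _ 0 j] by simp
      moreover have "(?u, ?v) \<notin> binomial_equiv (j + 1)"
      proof
        assume "(?u, ?v) \<in> binomial_equiv (j + 1)"
        then have "monom 1 (j + 1) dvd sign_poly ?u - sign_poly ?v"
          by (rule binomial_equiv_imp_dvd_sign_poly)
        then have "monom 1 1 dvd sign_poly (window ?y a n) - sign_poly (window ?y (Suc a) n)"
          by (rule dvd_sign_poly_tm_word_iter) simp
        then have "ones ?y a n = ones ?y (Suc a) n"
          unfolding monom_1_dvd_iff' by (simp add: coeff_0_window)
        then show False
          using a ones_Suc[of ?y a n] ones_Suc_left[of ?y a n]
          by (cases "?y (a + n)"; cases "?y a") simp_all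
      qed
      ultimately show "binomial_complexity j ?x (2 ^ j * n) < binomial_complexity (j + 1) ?x (2 ^ j * n)"
        using lift[OF jk] by (intro binomial_complexity_less[of ?u _ _ ?v]) simp_all
    qed
  qed
next
  let ?x = "thue_morse_iterate k s"
  show "binomial_complexity (k + 2) ?x = factor_complexity ?x"
  proof
    fix n
    have "inj_on (\<lambda>u. binomial_equiv (k + 2) `` {u}) (factors ?x n)"
    proof (rule inj_onI)
      fix u v assume uv: "u \<in> factors ?x n" "v \<in> factors ?x n"
        and "binomial_equiv (k + 2) `` {u} = binomial_equiv (k + 2) `` {v}"
      then have "(u, v) \<in> binomial_equiv (k + 2)"
        using eq_equiv_class[OF _ equiv_binomial_equiv] by blast
      then show "u = v"
        using thue_morse_iterate_factor_determined[OF st uv] binomial_equiv_imp_dvd_sign_poly by blast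
    qed
    moreover have "factors ?x n // binomial_equiv (k + 2) =
        (\<lambda>u. binomial_equiv (k + 2) `` {u}) ` factors ?x n"
      by (auto simp: quotient_def)
    ultimately show "binomial_complexity (k + 2) ?x n = factor_complexity ?x n"
      by (simp add: binomial_complexity_def factor_complexity_def card_image)
  qed
qed

section \<open>The Fibonacci word\<close>

abbreviation (input) fib_image :: "bit list \<Rightarrow> bit list" where
  "fib_image \<equiv> morph_word fibonacci_morphism"

text \<open>The word starts with 0, whose image has length two, so the image of its first
  \<open>n > 0\<close> letters has more than \<open>n\<close> letters and the lookup stays in
  range.\<close>

function fib :: "nat \<Rightarrow> bit" where
  "fib n = (if n = 0 then 0 else fib_image (map fib [0..<n]) ! n)"
  by auto
termination by (relation "measure id") auto

declare fib.simps [simp del]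

lemma fib_0 [simp]: "fib 0 = 0"
  by (simp add: fib.simps)

lemma fibonacci_morphism_simps [simp]:
  "fibonacci_morphism 0 = [0, 1]" "fibonacci_morphism 1 = [0]"
  by (simp_all add: fibonacci_morphism_def)

lemma length_fibonacci_morphism: "length (fibonacci_morphism a) \<ge> 1"
  by (cases a) simp_all

lemma length_fib_image: "length (fib_image u) \<ge> length u"
proof (induction u)
  case (Cons a u)
  then show ?case using length_fibonacci_morphism[of a] by simp
qed simp

lemma length_fib_image_prefix:
  assumes "x 0 = 0" "n > 0"
  shows "n < length (fib_image (window x 0 n))"
proof -
  obtain m where "n = Suc m" using assms(2) by (cases n) auto
  then show ?thesis using length_fib_image[of "window x (Suc 0) m"] assms(1) by (simp add: window_Suc)
qed

lemma fib_fixed: "morph_image fibonacci_morphism fib = fib"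
proof
  fix n
  show "morph_image fibonacci_morphism fib n = fib n"
  proof (cases "n = 0")
    case True
    then show ?thesis using morph_image_nth[of 0 fibonacci_morphism fib 1] by (simp add: window_Suc)
  next
    case False
    then show ?thesis
      using morph_image_nth[OF length_fib_image_prefix[of fib n]] fib.simps[of n]
      by (simp add: window_def)
  qed
qed

text \<open>Both letters have images starting with 0, so a fixed point starts with 0 and then obeys
  the recursion of \<open>fib\<close>.\<close>

lemma fib_fixed_unique:
  assumes fix_x: "morph_image fibonacci_morphism x = x"
  shows "x = fib"
proof
  have "morph_image fibonacci_morphism x 0 = 0"
    using morph_image_nth[of 0 fibonacci_morphism x 1] by (cases "x 0") (simp_all add: window_Suc)
  then have x0: "x 0 = 0" by (simp add: fix_x)
  fix n show "x n = fib n"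
  proof (induction n rule: less_induct)
    case (less n)
    show ?case
    proof (cases "n = 0")
      case False
      have "x n = fib_image (window x 0 n) ! n"
        using morph_image_nth[OF length_fib_image_prefix[of x n]] x0 False fix_x by simp
      also have "window x 0 n = map fib [0..<n]" using less by (simp add: window_def)
      finally show ?thesis using False fib.simps[of n] by simp
    qed (simp add: x0)
  qed
qed

lemma fibonacci_word_eq: "fibonacci_word = fib"
  unfolding fibonacci_word_def using fib_fixed fib_fixed_unique by (rule the_equality)

section \<open>Blocks and left special factors of the Fibonacci word\<close>

text \<open>Since \<open>fib\<close> is fixed, this is the position in \<open>fib\<close> where the
  image of letter number \<open>m\<close> starts.\<close>

definition fib_pos :: "nat \<Rightarrow> nat" where
  "fib_pos m = length (fib_image (window fib 0 m))"

lemma fib_pos_0 [simp]: "fib_pos 0 = 0"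
  by (simp add: fib_pos_def)

lemma fib_pos_Suc: "fib_pos (Suc m) = fib_pos m + (if fib m = 0 then 2 else 1)"
  by (cases "fib m") (simp_all add: fib_pos_def window_Suc_right)

lemma fib_nth_image: "n < fib_pos m \<Longrightarrow> fib n = fib_image (window fib 0 m) ! n"
  using morph_image_nth[of n fibonacci_morphism fib m] by (simp add: fib_fixed fib_pos_def)

lemma fib_fib_pos: "fib (fib_pos m) = 0"
  using fib_nth_image[of "fib_pos m" "Suc m"]
  by (cases "fib m") (simp_all add: fib_pos_Suc window_Suc_right nth_append, simp_all add: fib_pos_def)

text \<open>A block 01 contains the 1 itself; after a block 0 comes the 0 that starts the next
  block. So this letter tells which block it is.\<close>

lemma fib_Suc_fib_pos: "fib (Suc (fib_pos m)) = fib m + 1"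
proof (cases "fib m = 0")
  case True
  then show ?thesis
    using fib_nth_image[of "Suc (fib_pos m)" "Suc m"]
    by (simp add: fib_pos_Suc window_Suc_right nth_append, simp add: fib_pos_def)
next
  case False
  then show ?thesis using fib_fib_pos[of "Suc m"] by (simp add: fib_pos_Suc)
qed

lemma fib_pos_cover: "\<exists>m. i = fib_pos m \<or> i = Suc (fib_pos m) \<and> fib m = 0"
proof (induction i)
  case 0
  then show ?case by (intro exI[of _ 0]) simp
next
  case (Suc i)
  then obtain m where "i = fib_pos m \<or> i = Suc (fib_pos m) \<and> fib m = 0" by blast
  then show ?case
    by (intro exI[of _ "if i = fib_pos m \<and> fib m = 0 then m else Suc m"])
      (auto simp: fib_pos_Suc)
qed

lemma fib_zero_pos:
  assumes "fib i = 0"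
  obtains m where "i = fib_pos m"
proof -
  obtain m where "i = fib_pos m \<or> i = Suc (fib_pos m) \<and> fib m = 0" using fib_pos_cover by blast
  then have "i = fib_pos m" using assms fib_Suc_fib_pos[of m] by auto
  then show thesis by (rule that)
qed

lemma fib_one_pos:
  assumes "fib i = 1"
  obtains m where "Suc i = fib_pos (Suc m)" "fib m = 0"
proof -
  obtain m where "i = fib_pos m \<or> i = Suc (fib_pos m) \<and> fib m = 0" using fib_pos_cover by blast
  then have "i = Suc (fib_pos m)" "fib m = 0" using assms fib_fib_pos[of m] by auto
  then show thesis using that[of m] by (simp add: fib_pos_Suc)
qed

text \<open>This is the last letter of the preceding block; thus desubstitution complements left
  neighbours.\<close>

lemma fib_before_fib_pos: "fib (fib_pos (Suc m) - 1) = fib m + 1"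
proof (cases "fib m = 0")
  case True
  then show ?thesis using fib_Suc_fib_pos[of m] by (simp add: fib_pos_Suc)
next
  case False
  then show ?thesis using fib_fib_pos[of m] by (simp add: fib_pos_Suc)
qed

text \<open>Equal letters have equal blocks, and one more letter agrees after them since every block
  starts with 0; hence \<open>t \<le> e\<close> and not \<open>t < e\<close>.\<close>

lemma fib_pos_agree:
  assumes "\<And>q. q < r \<Longrightarrow> fib (a + q) = fib (b + q)"
  shows "\<exists>e. fib_pos (a + r) = fib_pos a + e \<and> fib_pos (b + r) = fib_pos b + e \<and> r \<le> e \<and>
    (\<forall>t\<le>e. fib (fib_pos a + t) = fib (fib_pos b + t))"
  using assms
proof (induction r)
  case 0
  then show ?case by (simp add: fib_fib_pos)
next
  case (Suc r)
  then obtain e where e: "fib_pos (a + r) = fib_pos a + e" "fib_pos (b + r) = fib_pos b + e" "r \<le> e"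
    and agree: "\<forall>t\<le>e. fib (fib_pos a + t) = fib (fib_pos b + t)" by auto
  have ab: "fib (a + r) = fib (b + r)" using Suc.prems by simp
  define l where "l = (if fib (a + r) = 0 then 2 else 1 :: nat)"
  have next_pos: "fib_pos (a + Suc r) = fib_pos a + (e + l)" "fib_pos (b + Suc r) = fib_pos b + (e + l)"
    using e ab by (simp_all add: fib_pos_Suc l_def)
  have "fib (fib_pos a + t) = fib (fib_pos b + t)" if t: "t \<le> e + l" for t
  proof -
    consider "t \<le> e" | "t = e + l" | "t = Suc e" using t by (cases "fib (a + r) = 0") (auto simp: l_def le_Suc_eq)
    then show ?thesis
    proof cases
      case 2
      then show ?thesis using next_pos fib_fib_pos by metis
    next
      case 3
      then show ?thesis
        using fib_Suc_fib_pos[of "a + r"] fib_Suc_fib_pos[of "b + r"] e ab by simp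
    qed (use agree in auto)
  qed
  moreover have "Suc r \<le> e + l" using e by (simp add: l_def)
  ultimately show ?case using next_pos by blast
qed

text \<open>A left special factor is desubstituted to a shorter left special factor.\<close>

lemma fib_left_special_prefix:
  assumes "\<And>t. t < n \<Longrightarrow> fib (Suc i + t) = fib (Suc j + t)" and "fib i = 1" "fib j = 0" and "t < n"
  shows "fib (Suc i + t) = fib t"
  using assms
proof (induction n arbitrary: i j t rule: less_induct)
  case (less n)
  obtain m where m: "Suc i = fib_pos (Suc m)" "fib m = 0" using fib_one_pos[OF less.prems(2)] .
  have "fib (Suc j) = 0"
    using less.prems(1)[of 0] less.prems(4) fib_fib_pos[of "Suc m"] m by simp
  then obtain m'' where m'': "Suc j = fib_pos m''" by (rule fib_zero_pos)
  then obtain m' where "m'' = Suc m'" by (cases m'') auto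
  then have "Suc j = fib_pos (Suc m')" using m'' by simp
  moreover from this have "fib m' + 1 = 0"
    using fib_before_fib_pos[of m'] less.prems(3) by (metis diff_Suc_1)
  ultimately have m': "Suc j = fib_pos (Suc m')" "fib m' = 1" by (simp, cases "fib m'") simp_all
  \<comment> \<open>Covering \<open>n - 1\<close> letters by blocks suffices, because
    \<open>fib_pos_agree\<close> yields one letter more than the blocks contain.\<close>
  define r where "r = (LEAST r. n - 1 \<le> fib_pos (Suc m + r) - Suc i)"
  have ex: "n - 1 \<le> fib_pos (Suc m + n) - Suc i"
  proof -
    have "fib_pos a + n \<le> fib_pos (a + n)" for a
      by (induction n) (auto simp: fib_pos_Suc)
    from this[of "Suc m"] show ?thesis using m by simp
  qed
  then have r: "n - 1 \<le> fib_pos (Suc m + r) - Suc i" unfolding r_def by (rule LeastI)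
  have least: "fib_pos (Suc m + q) - Suc i < n - 1" if "q < r" for q
    using not_less_Least[of q "\<lambda>r. n - 1 \<le> fib_pos (Suc m + r) - Suc i"] that by (simp add: r_def)
  \<comment> \<open>By minimality of \<open>r\<close> the block of letter \<open>q\<close> starts at
    an offset \<open>e < n - 1\<close>, so the letter after its start lies in the common window and
    identifies it.\<close>
  have agree: "fib (Suc m + q) = fib (Suc m' + q)" if "q < r" for q
    using that
  proof (induction q rule: less_induct)
    case (less q)
    then obtain e where e: "fib_pos (Suc m + q) = Suc i + e" "fib_pos (Suc m' + q) = Suc j + e"
      using fib_pos_agree[of q "Suc m" "Suc m'"] m m' by auto
    then have "Suc e < n" using least[OF less.prems] by simp
    then have "fib (Suc (Suc i + e)) = fib (Suc (Suc j + e))"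
      using \<open>\<And>t. t < n \<Longrightarrow> fib (Suc i + t) = fib (Suc j + t)\<close>[of "Suc e"] by simp
    then have "fib (Suc m + q) + 1 = fib (Suc m' + q) + 1"
      using fib_Suc_fib_pos[of "Suc m + q"] fib_Suc_fib_pos[of "Suc m' + q"] e by metis
    then show ?case by (simp only: add_right_cancel)
  qed
  have "r < n"
  proof (cases r)
    case (Suc r')
    obtain e where "fib_pos (Suc m + r') = Suc i + e" "r' \<le> e"
      using fib_pos_agree[of r' "Suc m" "Suc m'"] agree Suc m by auto
    then show ?thesis using least[of r'] Suc by simp
  qed (use less.prems(4) in simp)
  \<comment> \<open>The induction hypothesis applies with exchanged roles, as now the letter 1
    precedes the occurrence at \<open>Suc m'\<close>.\<close>
  then have "fib (Suc m' + q) = fib q" if "q < r" for q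
    using less.IH[of r m' m q] agree m m' that by simp
  then have "fib (Suc m + q) = fib (0 + q)" if "q < r" for q
    using agree that by simp
  then obtain e where "fib_pos (Suc m + r) = fib_pos (Suc m) + e"
    "\<forall>t\<le>e. fib (fib_pos (Suc m) + t) = fib (fib_pos 0 + t)"
    using fib_pos_agree[of r "Suc m" 0] by auto
  then show ?case using r m less.prems(4) by simp
qed

text \<open>The image of the prefix of length \<open>n\<close> gives the one of length
  \<open>n + 1\<close>, by the extra letter in \<open>fib_pos_agree\<close>; left neighbours are
  complemented, so the two occurrences swap roles.\<close>

lemma fib_prefix_left_special:
  "\<exists>i j. fib i = 1 \<and> fib j = 0 \<and> (\<forall>t<n. fib (Suc i + t) = fib t \<and> fib (Suc j + t) = fib t)"
proof (induction n)
  case 0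
  have "fib 1 = 1" using fib_Suc_fib_pos[of 0] by simp
  then show ?case using fib_0 by blast
next
  case (Suc n)
  then obtain i j where ij: "fib i = 1" "fib j = 0"
    "\<forall>t<n. fib (Suc i + t) = fib t" "\<forall>t<n. fib (Suc j + t) = fib t" by blast
  have step: "fib (fib_pos (Suc a) + t) = fib t" if "\<forall>t<n. fib (Suc a + t) = fib t" "t < Suc n" for a t
    using fib_pos_agree[of n "Suc a" 0] that by auto
  have "fib_pos (Suc a) = Suc (fib_pos (Suc a) - 1)" for a by (simp add: fib_pos_Suc)
  then show ?case
    using step[OF ij(3)] step[OF ij(4)] fib_before_fib_pos[of i] fib_before_fib_pos[of j] ij(1,2)
    by (intro exI[of _ "fib_pos (Suc j) - 1"] exI[of _ "fib_pos (Suc i) - 1"]) simp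
qed

text \<open>Dropping the first letter maps the factors of length \<open>n + 1\<close> onto those of
  length \<open>n\<close>. Only the prefix has two preimages, and removing the one that starts with
  0 makes the map bijective.\<close>

lemma sturmian_fib: "sturmian fib"
  unfolding sturmian_def
proof
  fix n show "card (factors fib n) = n + 1"
  proof (induction n)
    case 0
    have "factors fib 0 = {[]}" by (auto simp: factors_eq)
    then show ?case by simp
  next
    case (Suc n)
    let ?p = "window fib 0 n"
    obtain i j where ij: "fib i = 1" "fib j = 0" "window fib (Suc i) n = ?p" "window fib (Suc j) n = ?p"
      using fib_prefix_left_special[of n] by (auto simp: window_eq_iff)
    let ?A = "factors fib (Suc n) - {0 # ?p}"
    have "0 # ?p = window fib j (Suc n)" using ij by (simp add: window_Suc)
    then have mem: "0 # ?p \<in> factors fib (Suc n)" by simp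
    have inj: "inj_on tl ?A"
    proof -
      have no: False if "fib a = 1" "fib b = 0" "window fib (Suc a) n = window fib (Suc b) n"
        "window fib b (Suc n) \<in> ?A" for a b
      proof -
        have "window fib (Suc a) n = ?p"
          using fib_left_special_prefix[of n a b] that(1-3) by (simp add: window_eq_iff)
        then show False using that by (simp add: window_Suc)
      qed
      show ?thesis
      proof (rule inj_onI)
        fix u v assume u: "u \<in> ?A" and v: "v \<in> ?A" and tl: "tl u = tl v"
        obtain a b where ab: "u = window fib a (Suc n)" "v = window fib b (Suc n)"
          using u v by (auto simp: factors_eq)
        then have "window fib (Suc a) n = window fib (Suc b) n" using tl by (simp add: window_Suc)
        moreover from this have "fib a = fib b"
          using no[of a b] no[of b a] u v unfolding ab by (cases "fib a"; cases "fib b") simp_all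
        ultimately show "u = v" by (simp add: ab window_Suc)
      qed
    qed
    have "tl ` ?A = factors fib n"
    proof (intro equalityI subsetI)
      fix u assume "u \<in> tl ` ?A"
      then show "u \<in> factors fib n" by (auto simp: factors_eq window_Suc)
    next
      fix u assume "u \<in> factors fib n"
      then obtain a where u: "u = window fib a n" by (auto simp: factors_eq)
      show "u \<in> tl ` ?A"
      proof (cases "u = ?p")
        case True
        have "1 # ?p \<in> factors fib (Suc n)"
          using window_in_factors[of fib i "Suc n"] ij by (simp add: window_Suc)
        then have "1 # ?p \<in> ?A" by simp
        then show ?thesis using True by force
      next
        case False
        then obtain b where "a = Suc b" using u by (cases a) auto
        then have "window fib b (Suc n) \<in> ?A" "u = tl (window fib b (Suc n))"
          using u False window_in_factors[of fib b "Suc n"] by (auto simp: window_Suc)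
        then show ?thesis by blast
      qed
    qed
    then have "card ?A = n + 1" using card_image[OF inj] Suc by simp
    then show ?case using mem finite_factors[of fib "Suc n"] by (simp add: card_Diff_singleton)
  qed
qed

section \<open>Morphic words\<close>

text \<open>A stronger property that passes to the Thue--Morse image; for nonerasing
  \<open>h\<close>, the length condition gives prolongability.\<close>

definition nonerasing_morphic :: "(nat \<Rightarrow> 'a) \<Rightarrow> bool" where
  "nonerasing_morphic w \<longleftrightarrow>
    (\<exists>(A :: nat set) h x c. finite A \<and> range x \<subseteq> A \<and> (\<forall>a\<in>A. set (h a) \<subseteq> A) \<and> (\<forall>a. h a \<noteq> []) \<and>
      length (h (x 0)) \<ge> 2 \<and> morph_image h x = x \<and> w = c \<circ> x)"

lemma length_morph_word_nonerasing:
  assumes "\<And>a. h a \<noteq> []"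
  shows "length u \<le> length (morph_word h u)"
proof (induction u)
  case (Cons a u)
  then show ?case using assms[of a] by (cases "h a") auto
qed simp

lemma morph_word_prefix:
  "morph_word h (window x 0 m) = window (morph_image h x) 0 (length (morph_word h (window x 0 m)))"
  by (rule nth_equalityI) (simp_all add: morph_image_nth)

lemma morph_image_eqI:
  assumes "\<And>a. h a \<noteq> []"
    and "\<And>m. \<exists>l. morph_word h (window x 0 (f m)) = window y 0 l" and "\<And>m. m \<le> f m"
  shows "morph_image h x = y"
proof
  fix n
  obtain l where l: "morph_word h (window x 0 (f (Suc n))) = window y 0 l" using assms(2) by blast
  have "n < length (morph_word h (window x 0 (f (Suc n))))"
    using length_morph_word_nonerasing[of h "window x 0 (f (Suc n))"] assms(1) assms(3)[of "Suc n"] by simp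
  then show "morph_image h x n = y n" using morph_image_nth[of n h x "f (Suc n)"] l by simp
qed

lemma nonerasing_morphic_imp_morphic: "nonerasing_morphic w \<Longrightarrow> morphic w"
proof -
  assume "nonerasing_morphic w"
  then obtain A :: "nat set" and h x c where *: "finite A" "range x \<subseteq> A" "\<forall>a\<in>A. set (h a) \<subseteq> A"
    "\<And>a. h a \<noteq> []" "length (h (x 0)) \<ge> 2" "morph_image h x = x" "w = c \<circ> x"
    unfolding nonerasing_morphic_def by blast
  obtain a u where hx: "h (x 0) = a # u" "u \<noteq> []"
    using *(5) by (cases "h (x 0)") (auto simp: Suc_le_length_iff)
  have "x 0 = a" using morph_image_nth[of 0 h x 1] *(6) hx by (simp add: window_Suc)
  moreover have "(morph_word h ^^ n) u \<noteq> []" for n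
  proof (induction n)
    case (Suc n)
    then show ?case using length_morph_word_nonerasing[of h "(morph_word h ^^ n) u"] *(4) by auto
  qed (simp add: hx)
  ultimately have "prolongable h (x 0)" using hx by (auto simp: prolongable_def)
  then show ?thesis using * unfolding morphic_def by blast
qed

text \<open>The letter \<open>2 * a + r\<close> stands for position \<open>r\<close> in the block \<open>\<phi>(a)\<close>.\<close>

definition double_letters :: "nat list \<Rightarrow> nat list" where
  "double_letters u = concat (map (\<lambda>a. [2 * a, 2 * a + 1]) u)"

text \<open>The doubled image of a letter is shared by its two copies. Cutting before the last
  letter keeps both parts nonempty and leaves the initial letter an image of length at least
  two.\<close>

definition double_morphism :: "(nat \<Rightarrow> nat list) \<Rightarrow> nat \<Rightarrow> nat list" where
  "double_morphism h e =
    (let u = double_letters (h (e div 2)) in if even e then butlast u else [last u])"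

lemma double_letters_simps [simp]:
  "double_letters [] = []"
  "double_letters (a # u) = 2 * a # (2 * a + 1) # double_letters u"
  "double_letters (u @ v) = double_letters u @ double_letters v"
  by (simp_all add: double_letters_def)

lemma length_double_letters [simp]: "length (double_letters u) = 2 * length u"
  by (induction u) simp_all

lemma morph_double_letters:
  assumes "\<And>a. h a \<noteq> []"
  shows "morph_word (double_morphism h) (double_letters u) = double_letters (morph_word h u)"
proof (induction u)
  case (Cons a u)
  have "double_letters (h a) \<noteq> []" using assms[of a] by (cases "h a") auto
  then show ?case using Cons by (simp add: double_morphism_def Let_def)
qed simp

lemma window_double:
  "window (\<lambda>n. 2 * x (n div 2) + n mod 2) 0 (2 * m) = double_letters (window x 0 m)"
  by (induction m) (simp_all add: window_Suc_right)

text \<open>The word of letters paired with positions in blocks is fixed by the doubled morphism;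
  the coding complements \<open>c\<close> at odd letters.\<close>

lemma nonerasing_morphic_thue_morse:
  assumes "nonerasing_morphic w"
  shows "nonerasing_morphic (morph_image thue_morse w)"
proof -
  obtain A :: "nat set" and h x c where A: "finite A" "range x \<subseteq> A" "\<forall>a\<in>A. set (h a) \<subseteq> A"
    and ne: "\<And>a. h a \<noteq> []" and "length (h (x 0)) \<ge> 2" and fx: "morph_image h x = x" and w: "w = c \<circ> x"
    using assms unfolding nonerasing_morphic_def by blast
  define y where "y n = 2 * x (n div 2) + n mod 2" for n
  define B where "B = {e. e div 2 \<in> A}"
  have "B \<subseteq> (\<lambda>a. 2 * a) ` A \<union> (\<lambda>a. 2 * a + 1) ` A"
  proof
    fix e assume "e \<in> B"
    then show "e \<in> (\<lambda>a. 2 * a) ` A \<union> (\<lambda>a. 2 * a + 1) ` A"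
      unfolding B_def by (cases "even e") (auto elim!: evenE oddE)
  qed
  then have "finite B" using A(1) by (meson finite_Un finite_imageI finite_subset)
  moreover have "range y \<subseteq> B" using A(2) by (auto simp: y_def B_def)
  moreover have "set (double_morphism h e) \<subseteq> B" if "e \<in> B" for e
  proof -
    have "set (double_letters u) \<subseteq> B" if "set u \<subseteq> A" for u
      using that by (induction u) (auto simp: B_def)
    then have sub: "set (double_letters (h (e div 2))) \<subseteq> B" using A(3) that by (auto simp: B_def)
    have "double_letters (h (e div 2)) \<noteq> []" using ne by (metis length_0_conv length_double_letters mult_is_0 zero_neq_numeral)
    then show ?thesis using sub by (auto simp: double_morphism_def Let_def dest: in_set_butlastD)
  qed
  moreover have len: "length (double_morphism h e) \<ge> (if even e then 2 * length (h (e div 2)) - 1 else 1)" for e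
    by (simp add: double_morphism_def Let_def)
  have ne': "double_morphism h e \<noteq> []" for e
    using len[of e] ne[of "e div 2"] by (cases "h (e div 2)") (auto split: if_splits)
  moreover have "length (double_morphism h (y 0)) \<ge> 2"
    using len[of "y 0"] \<open>length (h (x 0)) \<ge> 2\<close> by (simp add: y_def)
  moreover have "morph_image (double_morphism h) y = y"
  proof (rule morph_image_eqI[where f = "\<lambda>m. 2 * m"])
    show "double_morphism h e \<noteq> []" for e by (rule ne')
    fix m
    let ?l = "length (morph_word h (window x 0 m))"
    have y: "window y 0 (2 * l) = double_letters (window x 0 l)" for l
      unfolding y_def by (rule window_double)
    have "morph_word h (window x 0 m) = window x 0 ?l"
      using morph_word_prefix[of h x m] fx by simp
    then have "morph_word (double_morphism h) (window y 0 (2 * m)) = window y 0 (2 * ?l)"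
      unfolding y morph_double_letters[OF ne] by simp
    then show "\<exists>l. morph_word (double_morphism h) (window y 0 (2 * m)) = window y 0 l" ..
  qed simp
  moreover have "morph_image thue_morse w = (\<lambda>e. if even e then c (e div 2) else c (e div 2) + 1) \<circ> y"
  proof
    fix n
    show "morph_image thue_morse w n = ((\<lambda>e. if even e then c (e div 2) else c (e div 2) + 1) \<circ> y) n"
      using tm_image_nth[of w "n div 2"]
      by (cases "even n") (auto elim!: evenE oddE simp: y_def w)
  qed
  ultimately show ?thesis unfolding nonerasing_morphic_def by blast
qed

lemma nonerasing_morphic_fib: "nonerasing_morphic fib"
proof -
  define d :: "nat \<Rightarrow> bit" where "d n = (if n = 0 then 0 else 1)" for n
  define x :: "nat \<Rightarrow> nat" where "x n = (if fib n = 0 then 0 else 1)" for n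
  define h :: "nat \<Rightarrow> nat list" where "h n = (if n = 0 then [0, 1] else [0])" for n
  have ne: "h a \<noteq> []" for a by (simp add: h_def)
  have x_window: "window x 0 m = map (\<lambda>b. if b = 0 then 0 else 1) (window fib 0 m)" for m
    by (simp add: window_def x_def)
  have map_h: "morph_word h (map (\<lambda>b. if b = 0 then 0 else 1) u)
      = map (\<lambda>b. if b = 0 then 0 else 1) (fib_image u)" for u
  proof (induction u)
    case (Cons b u)
    then show ?case by (cases b) (simp_all add: h_def)
  qed simp
  have "morph_image h x = x"
  proof (rule morph_image_eqI[where f = "\<lambda>m. m"])
    show "h a \<noteq> []" for a by (rule ne)
    fix m
    have "fib_image (window fib 0 m) = window fib 0 (fib_pos m)"
      using morph_word_prefix[of fibonacci_morphism fib m]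
      by (simp add: fib_fixed fib_pos_def fibonacci_morphism_def)
    then show "\<exists>l. morph_word h (window x 0 m) = window x 0 l"
      by (intro exI[of _ "fib_pos m"]) (simp only: x_window map_h)
  qed simp
  moreover have "fib = d \<circ> x"
  proof
    show "fib n = (d \<circ> x) n" for n by (cases "fib n") (simp_all add: d_def x_def)
  qed
  moreover have "range x \<subseteq> {0, 1}" "\<forall>a\<in>{0, 1}. set (h a) \<subseteq> {0, 1}" "length (h (x 0)) \<ge> 2"
    by (auto simp: x_def h_def)
  ultimately show ?thesis unfolding nonerasing_morphic_def using ne
    by (intro exI[of _ "{0, 1}"] exI[of _ h] exI[of _ x] exI[of _ d]) simp
qed

lemma morphic_thue_morse_iterate_fib: "morphic (thue_morse_iterate k fib)"
proof -
  have "nonerasing_morphic (thue_morse_iterate k fib)"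
    by (induction k) (simp_all add: thue_morse_iterate_simps nonerasing_morphic_fib nonerasing_morphic_thue_morse)
  then show ?thesis by (rule nonerasing_morphic_imp_morphic)
qed

theorem theorem7p2:
  shows "(\<forall>s :: nat \<Rightarrow> bit. sturmian s \<longrightarrow>
            (\<forall>k. strict_binomial_chain k (thue_morse_iterate k s))) \<and>
         sturmian fibonacci_word \<and>
         (\<forall>k. morphic (thue_morse_iterate k fibonacci_word) \<and>
              strict_binomial_chain k (thue_morse_iterate k fibonacci_word))"
  unfolding fibonacci_word_eq
  by (intro conjI allI impI sturmian_strict_binomial_chain sturmian_fib morphic_thue_morse_iterate_fib)

end
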